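(* Let $\psi \in L^1(\mathbb{R}_+^{\times})$ with $\int_1^{\infty}\psi(x)\,\frac{dx}{x} = 1$ and $Z(\tilde{\psi}) = \emptyset$. Then for every $f \in L^{\infty}(\mathbb{R}_+^{\times})$ and every $\alpha$, \[\lim_{x\to\infty}\int_1^x f(t)\psi(x/t)\,\frac{dt}{t} = \alpha\] if and only if \[\lim_{x\to\infty}\int_x^{\infty} f(t)\psi(t/x)\,\frac{dt}{t} = \alpha.\] In other words, the summability methods $M_\psi$ and $M_\psi^*$ defined by these two limits are equivalent.
   Context: $\mathbb{R}^{\times} = (0,\infty)$ with Haar measure $dt/t$, $\mathbb{R}_+^{\times} = [1,\infty)$ with measure $dt/t$; functions are complex-valued. $\tilde{\psi} \in L^1(\mathbb{R}^{\times})$ equals $\psi$ on $[1,\infty)$ and $0$ on $(0,1)$. For $g \in L^1(\mathbb{R}^\times)$, $\hat g(x) = \int_0^\infty g(t)t^{-ix}\,\frac{dt}{t}$ and $Z(g) = \{x \in \mathbb{R}: \hat g(x) = 0\}$. *)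

theory Defs
  imports "HOL-Analysis.Analysis"
begin

definition haar_mult :: "real measure" where
  "haar_mult = density (restrict_space lborel {0<..}) (\<lambda>t. ennreal (1 / t))"

definition ext_zero :: "(real \<Rightarrow> complex) \<Rightarrow> real \<Rightarrow> complex" where
  "ext_zero \<psi> t = (if 1 \<le> t then \<psi> t else 0)"

definition mult_hat :: "(real \<Rightarrow> complex) \<Rightarrow> real \<Rightarrow> complex" where
  "mult_hat g x = (LINT t|haar_mult. g t * cis (- x * ln t))"

definition zero_set :: "(real \<Rightarrow> complex) \<Rightarrow> real set" where
  "zero_set g = {x. mult_hat g x = 0}"

end

theory Submission
  imports Defs "HOL-Probability.Sinc_Integral"
begin

text \<open>The substitution \<open>t = exp u\<close> turns the two means into the convolutions of one bounded function \<open>F\<close> with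
  \<open>k u = \<psi> (exp u)\<close> and with its reflection, so both implications are instances of Wiener's Tauberian
  theorem on the line. That theorem is obtained without Banach algebra theory. The kernels \<open>h\<close> with
  \<open>(F * h) x \<longlongrightarrow> 0\<close> form a closed ideal of \<open>L\<^sup>1\<close>. If \<open>V * h = h\<close> for a de la Vallee Poussin kernel \<open>V\<close>
  modulated to the frequency \<open>\<xi>\<close> and of small enough bandwidth, then \<open>k * V\<close> is so close to \<open>c V\<close>, where
  \<open>c \<noteq> 0\<close> is the Fourier transform of \<open>k\<close> at \<open>\<xi>\<close>, that \<open>\<bar>c\<bar>\<close> times the upper limit of \<open>\<bar>F * h\<bar>\<close> is at most
  a smaller multiple of the same upper limit; hence \<open>h\<close> lies in the ideal. A wide Fejer kernel is a finite sum
  of such narrow modulated ones, and Fejer kernels form an approximate identity.\<close>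

subsection \<open>Translations and the mean norm\<close>

definition L1norm :: "(real \<Rightarrow> complex) \<Rightarrow> real" where
  "L1norm g = (LINT x|lborel. norm (g x))"

text \<open>The Bochner integral is 0 where the product is not integrable. For two integrable
  functions the value is therefore meaningful only almost everywhere; for a bounded measurable and
  an integrable one it is meaningful at every point.\<close>

definition conv :: "(real \<Rightarrow> complex) \<Rightarrow> (real \<Rightarrow> complex) \<Rightarrow> real \<Rightarrow> complex" where
  "conv f g x = (LINT y|lborel. f (x - y) * g y)"

text \<open>The modulus of continuity in L1. Averaged against a kernel, it bounds the error made
  when convolution with that kernel is replaced by multiplication by its integral.\<close>

definition transl_modulus :: "(real \<Rightarrow> complex) \<Rightarrow> real \<Rightarrow> real" where
  "transl_modulus g a = L1norm (\<lambda>x. g (x - a) - g x)"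

lemma integrable_shift:
  fixes g :: "real \<Rightarrow> 'a::{banach, second_countable_topology}"
  assumes "integrable lborel g"
  shows "integrable lborel (\<lambda>x. g (x - a))"
  using lborel_integrable_real_affine[OF assms, of 1 "-a"] by simp

lemma integral_shift:
  fixes g :: "real \<Rightarrow> 'a::{banach, second_countable_topology}"
  shows "(LINT x|lborel. g (x - a)) = (LINT x|lborel. g x)"
  using lborel_integral_real_affine[of 1 g "-a"] by simp

lemma integral_reflect_shift:
  fixes g :: "real \<Rightarrow> 'a::{banach, second_countable_topology}"
  shows "(LINT x|lborel. g (a - x)) = (LINT x|lborel. g x)"
  using lborel_integral_real_affine[of "-1" g a] by simp

lemma integrable_reflect_shift:
  fixes g :: "real \<Rightarrow> 'a::{banach, second_countable_topology}"
  assumes "integrable lborel g"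
  shows "integrable lborel (\<lambda>x. g (a - x))"
  using lborel_integrable_real_affine[OF assms, of "-1" a] by simp

lemma integral_scale:
  fixes g :: "real \<Rightarrow> 'a::{banach, second_countable_topology}"
  assumes "d > 0"
  shows "d *\<^sub>R (LINT x|lborel. g (d * x)) = (LINT x|lborel. g x)"
  using lborel_integral_real_affine[of d g 0] assms by simp

lemma integrable_scale:
  fixes g :: "real \<Rightarrow> 'a::{banach, second_countable_topology}"
  assumes "integrable lborel g" "d \<noteq> 0"
  shows "integrable lborel (\<lambda>x. g (d * x))"
  using lborel_integrable_real_affine[OF assms(1), of d 0] assms by simp

lemma L1norm_nonneg: "0 \<le> L1norm g"
  unfolding L1norm_def by simp

lemma L1norm_shift: "L1norm (\<lambda>x. g (x - a)) = L1norm g"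
  unfolding L1norm_def by (rule integral_shift)

lemma L1norm_triangle:
  assumes "integrable lborel g" "integrable lborel h"
  shows "L1norm (\<lambda>x. g x + h x) \<le> L1norm g + L1norm h"
proof -
  have "L1norm (\<lambda>x. g x + h x) \<le> (LINT x|lborel. norm (g x) + norm (h x))"
    unfolding L1norm_def using assms
    by (intro integral_mono) (auto intro!: norm_triangle_ineq)
  also have "\<dots> = L1norm g + L1norm h"
    unfolding L1norm_def using assms by (intro Bochner_Integration.integral_add) auto
  finally show ?thesis .
qed

lemma L1norm_minus_commute: "L1norm (\<lambda>x. g x - h x) = L1norm (\<lambda>x. h x - g x)"
  unfolding L1norm_def by (simp add: norm_minus_commute)

subsection \<open>Continuity of translation in the mean\<close>

lemma transl_modulus_nonneg: "0 \<le> transl_modulus g a"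
  unfolding transl_modulus_def by (rule L1norm_nonneg)

lemma transl_modulus_le:
  assumes "integrable lborel g"
  shows "transl_modulus g a \<le> 2 * L1norm g"
proof -
  have "transl_modulus g a \<le> L1norm (\<lambda>x. g (x - a)) + L1norm (\<lambda>x. - g x)"
    using L1norm_triangle[of "\<lambda>x. g (x - a)" "\<lambda>x. - g x"] assms
    by (simp add: transl_modulus_def integrable_shift)
  then show ?thesis
    by (simp add: L1norm_shift) (simp add: L1norm_def)
qed

lemma transl_modulus_add:
  assumes "integrable lborel g" "integrable lborel h"
  shows "transl_modulus (\<lambda>x. g x + h x) a \<le> transl_modulus g a + transl_modulus h a"
  using L1norm_triangle[of "\<lambda>x. g (x - a) - g x" "\<lambda>x. h (x - a) - h x"] assms
  by (simp add: transl_modulus_def integrable_shift algebra_simps)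

text \<open>The modulus of \<open>g - h\<close> is at most twice its L1 norm, uniformly in the
  shift, so the property survives L1 limits.\<close>

lemma transl_modulus_closed:
  assumes g: "integrable lborel g"
    and appr: "\<And>e. e > 0 \<Longrightarrow> \<exists>h. integrable lborel h \<and> (transl_modulus h \<longlongrightarrow> 0) (at 0)
                      \<and> L1norm (\<lambda>x. g x - h x) < e"
  shows "(transl_modulus g \<longlongrightarrow> 0) (at 0)"
proof (rule tendstoI)
  fix e :: real assume e: "e > 0"
  obtain h where h: "integrable lborel h" and lim: "(transl_modulus h \<longlongrightarrow> 0) (at 0)"
    and close: "L1norm (\<lambda>x. g x - h x) < e / 4"
    using appr[of "e/4"] e by auto
  have "\<forall>\<^sub>F a in at 0. transl_modulus h a < e / 2"
    using order_tendstoD(2)[OF lim, of "e/2"] e by simp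
  then show "\<forall>\<^sub>F a in at 0. dist (transl_modulus g a) 0 < e"
  proof eventually_elim
    case (elim a)
    have "transl_modulus g a \<le> transl_modulus h a + transl_modulus (\<lambda>x. g x - h x) a"
      using transl_modulus_add[of h "\<lambda>x. g x - h x" a] g h by simp
    also have "\<dots> < e / 2 + 2 * (e / 4)"
      using elim transl_modulus_le[of "\<lambda>x. g x - h x" a] g h close by (intro add_less_le_mono) auto
    finally show ?case using transl_modulus_nonneg[of g a] by simp
  qed
qed

text \<open>For an open set only the positive part of the difference of indicators needs pointwise
  convergence: its integral is half the integral of the absolute value, by translation invariance.\<close>

lemma transl_modulus_indicator_open:
  fixes U :: "real set"
  assumes U: "open U" and fin: "emeasure lborel U < \<infinity>"
  shows "(transl_modulus (\<lambda>x. indicator U x *\<^sub>R c) \<longlongrightarrow> 0) (at 0)"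
proof -
  let ?u = "indicator U :: real \<Rightarrow> real"
  have U_meas[measurable]: "U \<in> sets borel" using U by simp
  have int: "integrable lborel ?u" using fin by simp
  have int': "integrable lborel (\<lambda>x. ?u (x - a))" for a by (rule integrable_shift[OF int])
  have eq: "transl_modulus (\<lambda>x. indicator U x *\<^sub>R c) a
      = 2 * norm c * (LINT x|lborel. max 0 (?u x - ?u (x - a)))" for a
  proof -
    have "transl_modulus (\<lambda>x. indicator U x *\<^sub>R c) a = (LINT x|lborel. norm c * \<bar>?u (x - a) - ?u x\<bar>)"
      unfolding transl_modulus_def L1norm_def
      by (intro Bochner_Integration.integral_cong) (auto simp: indicator_def)
    also have "\<dots> = norm c * (LINT x|lborel. \<bar>?u (x - a) - ?u x\<bar>)" by simp
    also have "(LINT x|lborel. \<bar>?u (x - a) - ?u x\<bar>)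
        = (LINT x|lborel. 2 * max 0 (?u x - ?u (x - a)) - (?u x - ?u (x - a)))"
      by (intro Bochner_Integration.integral_cong) (auto simp: indicator_def)
    also have "\<dots> = 2 * (LINT x|lborel. max 0 (?u x - ?u (x - a))) - ((LINT x|lborel. ?u x) - (LINT x|lborel. ?u (x - a)))"
      using int int' by simp
    also have "(LINT x|lborel. ?u (x - a)) = (LINT x|lborel. ?u x)" by (rule integral_shift)
    finally show ?thesis by simp
  qed
  have "((\<lambda>a. LINT x|lborel. max 0 (?u x - ?u (x - a))) \<longlongrightarrow> (LINT x::real|lborel. (0::real))) (at 0)"
  proof (rule tendsto_at_iff_sequentially[THEN iffD2], intro allI impI, unfold o_def)
    fix X :: "nat \<Rightarrow> real" assume "\<forall>i. X i \<in> UNIV - {0}" and X: "X \<longlonglongrightarrow> 0"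
    show "(\<lambda>i. LINT x|lborel. max 0 (?u x - ?u (x - X i))) \<longlonglongrightarrow> (LINT x::real|lborel. (0::real))"
    proof (rule integral_dominated_convergence[where w = ?u])
      show "AE x in lborel. (\<lambda>i. max 0 (?u x - ?u (x - X i))) \<longlonglongrightarrow> 0"
      proof (intro AE_I2)
        fix x :: real
        show "(\<lambda>i. max 0 (?u x - ?u (x - X i))) \<longlonglongrightarrow> 0"
        \<comment> \<open>A point of the open set \<open>U\<close> stays in \<open>U\<close> under
          small shifts; outside \<open>U\<close> the positive part is 0 for every shift. Boundary
          points, which may have positive measure, thus cause no trouble.\<close>
        proof (cases "x \<in> U")
          case True
          have "(\<lambda>i. x - X i) \<longlonglongrightarrow> x" using tendsto_diff[OF tendsto_const X, of x] by simp
          then have "\<forall>\<^sub>F i in sequentially. x - X i \<in> U" using topological_tendstoD[OF _ U True] by blast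
          then have "\<forall>\<^sub>F i in sequentially. max 0 (?u x - ?u (x - X i)) = 0"
            by eventually_elim (auto simp: True)
          then show ?thesis by (rule tendsto_eventually)
        qed (simp add: max_absorb1)
      qed
      show "AE x in lborel. norm (max 0 (?u x - ?u (x - X i))) \<le> ?u x" for i
        by (auto simp: indicator_def)
    qed (use int in auto)
  qed
  from tendsto_mult_left[OF this, of "2 * norm c"] show ?thesis by (simp add: eq[abs_def])
qed

text \<open>Outer regularity gives an open superset of nearly the same measure, whose indicator is
  close in L1.\<close>

lemma transl_modulus_indicator:
  fixes A :: "real set"
  assumes A: "A \<in> sets lborel" and fin: "emeasure lborel A < \<infinity>"
  shows "(transl_modulus (\<lambda>x. indicator A x *\<^sub>R c) \<longlongrightarrow> 0) (at 0)"
proof (rule transl_modulus_closed)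
  show "integrable lborel (\<lambda>x. indicator A x *\<^sub>R c)" using A fin by auto
  fix e :: real assume e: "e > 0"
  define d where "d = e / (norm c + 1)"
  have d: "d > 0" using e unfolding d_def by (intro divide_pos_pos) (auto simp: add_nonneg_pos)
  obtain U where U: "open U" "A \<subseteq> U" "emeasure lborel (U - A) < d"
    using outer_regular_lborel[of A d] A d by auto
  have [measurable]: "U \<in> sets borel" "A \<in> sets borel" using U A by auto
  have "emeasure lborel U \<le> emeasure lborel A + emeasure lborel (U - A)"
    using U by (subst plus_emeasure) (auto intro!: emeasure_mono)
  also have "\<dots> < \<infinity>" using fin order_less_trans[OF U(3) ennreal_less_top] by simp
  finally have finU: "emeasure lborel U < \<infinity>" .
  have "L1norm (\<lambda>x. indicator A x *\<^sub>R c - indicator U x *\<^sub>R c)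
      = (LINT x|lborel. norm c * indicator (U - A) x)"
    unfolding L1norm_def using U by (intro Bochner_Integration.integral_cong) (auto simp: indicator_def)
  also have "\<dots> = norm c * measure lborel (U - A)" by simp
  also have "\<dots> \<le> norm c * d"
    using U(3) d by (intro mult_left_mono) (auto simp: measure_def enn2real_leI)
  also have "\<dots> < e"
  proof -
    have "0 < norm c + 1" by (simp add: add_nonneg_pos)
    then show ?thesis unfolding d_def using e by (simp add: field_simps)
  qed
  finally have "L1norm (\<lambda>x. indicator A x *\<^sub>R c - indicator U x *\<^sub>R c) < e" .
  then show "\<exists>h. integrable lborel h \<and> (transl_modulus h \<longlongrightarrow> 0) (at 0)
      \<and> L1norm (\<lambda>x. indicator A x *\<^sub>R c - h x) < e"
    using transl_modulus_indicator_open[OF U(1) finU, of c] finU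
    by (intro exI[of _ "\<lambda>x. indicator U x *\<^sub>R c"]) auto
qed

text \<open>Induction over integrable functions: indicators, sums, and L1 limits of simple
  functions.\<close>

lemma tendsto_transl_modulus:
  assumes "integrable lborel g"
  shows "(transl_modulus g \<longlongrightarrow> 0) (at 0)"
  using assms
proof (induction rule: integrable_induct)
  case (base A c)
  then show ?case by (rule transl_modulus_indicator)
next
  case (add f g)
  show ?case
  proof (rule tendsto_sandwich[OF _ _ tendsto_const])
    show "((\<lambda>a. transl_modulus f a + transl_modulus g a) \<longlongrightarrow> 0) (at 0)"
      using tendsto_add[OF add(3,4)] by simp
  qed (use transl_modulus_add[OF add(1,2)] transl_modulus_nonneg in auto)
next
  case (lim f s)
  have "(\<lambda>i. LINT x|lborel. norm (f x - s i x)) \<longlonglongrightarrow> (LINT x::real|lborel. (0::real))"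
  \<comment> \<open>The simple approximants satisfy
    \<open>norm (s i x) \<le> 2 * norm (f x)\<close>, hence the factor 3.\<close>
  proof (rule integral_dominated_convergence[where w = "\<lambda>x. 3 * norm (f x)"])
    show "AE x in lborel. (\<lambda>i. norm (f x - s i x)) \<longlonglongrightarrow> 0"
    proof (intro AE_I2)
      fix x :: real
      have "(\<lambda>i. norm (f x - s i x)) \<longlonglongrightarrow> norm (f x - f x)"
        by (intro tendsto_intros lim) simp
      then show "(\<lambda>i. norm (f x - s i x)) \<longlonglongrightarrow> 0" by simp
    qed
    show "AE x in lborel. norm (norm (f x - s i x)) \<le> 3 * norm (f x)" for i
    proof (intro AE_I2)
      fix x :: real
      have "norm (f x - s i x) \<le> norm (f x) + norm (s i x)" by (rule norm_triangle_ineq4)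
      then show "norm (norm (f x - s i x)) \<le> 3 * norm (f x)" using lim(3)[of x i] by simp
    qed
  qed (use lim in auto)
  then have conv: "(\<lambda>i. L1norm (\<lambda>x. f x - s i x)) \<longlonglongrightarrow> 0" by (simp add: L1norm_def)
  show ?case
  proof (rule transl_modulus_closed[OF lim(4)])
    fix e :: real assume "e > 0"
    then have "\<forall>\<^sub>F i in sequentially. L1norm (\<lambda>x. f x - s i x) < e"
      by (rule order_tendstoD(2)[OF conv])
    then obtain i where "L1norm (\<lambda>x. f x - s i x) < e" by (auto dest: eventually_happens)
    then show "\<exists>h. integrable lborel h \<and> (transl_modulus h \<longlongrightarrow> 0) (at 0) \<and> L1norm (\<lambda>x. f x - h x) < e"
      using lim by blast
  qed
qed

lemma borel_measurable_transl_modulus: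
  assumes "integrable lborel g"
  shows "transl_modulus g \<in> borel_measurable borel"
proof -
  have [measurable]: "g \<in> borel_measurable borel" using assms by auto
  show ?thesis unfolding transl_modulus_def L1norm_def by measurable
qed

text \<open>The one limit behind both approximations: with \<open>g\<close> a de la Vallee Poussin
  kernel it makes the local inversion a contraction, with \<open>k\<close> a Fejer kernel it gives
  an approximate identity.\<close>

lemma tendsto_integral_transl_modulus:
  fixes k :: "real \<Rightarrow> complex"
  assumes g: "integrable lborel g" and k: "integrable lborel k" and X: "X \<longlonglongrightarrow> 0"
  shows "(\<lambda>i. LINT y|lborel. transl_modulus g (X i * y) * norm (k y)) \<longlonglongrightarrow> 0"
proof -
  note [measurable] = borel_measurable_transl_modulus[OF g] borel_measurable_integrable[OF k]
  have "(\<lambda>i. LINT y|lborel. transl_modulus g (X i * y) * norm (k y)) \<longlonglongrightarrow> (LINT y::real|lborel. (0::real))"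
  proof (rule integral_dominated_convergence[where w = "\<lambda>y. 2 * L1norm g * norm (k y)"])
    \<comment> \<open>The modulus is 0 at shift 0, so the punctured limit is continuity, and
      \<open>X i * y\<close> may be 0.\<close>
    have "isCont (transl_modulus g) 0"
      using tendsto_transl_modulus[OF g] by (simp add: isCont_def transl_modulus_def L1norm_def)
    moreover have "(\<lambda>i. X i * y) \<longlonglongrightarrow> 0" for y using tendsto_mult_left_zero[OF X] .
    ultimately have "(\<lambda>i. transl_modulus g (X i * y)) \<longlonglongrightarrow> 0" for y
      using isCont_tendsto_compose[of 0 "transl_modulus g" "\<lambda>i. X i * y"]
      by (simp add: transl_modulus_def L1norm_def)
    then show "AE y in lborel. (\<lambda>i. transl_modulus g (X i * y) * norm (k y)) \<longlonglongrightarrow> 0"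
      by (intro AE_I2 tendsto_mult_left_zero)
    show "AE y in lborel. norm (transl_modulus g (X i * y) * norm (k y)) \<le> 2 * L1norm g * norm (k y)" for i
      using transl_modulus_le[OF g] transl_modulus_nonneg
      by (intro AE_I2) (simp add: abs_mult mult_right_mono)
  qed (use k in auto)
  then show ?thesis by simp
qed

subsection \<open>Convolution\<close>

lemma conv_commute: "conv g h x = conv h g x"
  unfolding conv_def
  by (subst integral_reflect_shift[symmetric, of _ x]) (simp add: mult.commute)

lemma integrable_conv_bounded:
  fixes f g :: "real \<Rightarrow> complex"
  assumes [measurable]: "f \<in> borel_measurable borel" and "\<And>x. norm (f x) \<le> B" "integrable lborel g"
  shows "integrable lborel (\<lambda>y. f (x - y) * g y)"
proof (rule Bochner_Integration.integrable_bound[where f = "\<lambda>y. B * norm (g y)"])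
  have "0 \<le> B" using assms(2) norm_ge_zero order_trans by blast
  then show "AE y in lborel. norm (f (x - y) * g y) \<le> norm (B * norm (g y))"
    using assms(2) by (auto simp: norm_mult intro!: mult_right_mono)
qed (use assms in auto)

lemma norm_conv_le:
  assumes "f \<in> borel_measurable borel" "\<And>x. norm (f x) \<le> B" "integrable lborel g"
  shows "norm (conv f g x) \<le> B * L1norm g"
proof -
  have "norm (conv f g x) \<le> (LINT y|lborel. norm (f (x - y) * g y))"
    unfolding conv_def by (rule integral_norm_bound)
  also have "\<dots> \<le> (LINT y|lborel. B * norm (g y))"
    using integrable_norm[OF integrable_conv_bounded[OF assms, of x]] assms
    by (intro integral_mono) (auto simp: norm_mult intro!: mult_right_mono)
  finally show ?thesis by (simp add: L1norm_def)
qed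

lemma borel_measurable_conv[measurable]:
  assumes [measurable]: "f \<in> borel_measurable borel" "g \<in> borel_measurable borel"
  shows "conv f g \<in> borel_measurable borel"
  unfolding conv_def by measurable

lemma integrable_conv_pair:
  fixes g h :: "real \<Rightarrow> complex"
  assumes g: "integrable lborel g" and h: "integrable lborel h"
  shows "integrable (lborel \<Otimes>\<^sub>M lborel) (\<lambda>(y, x). g (x - y) * h y)"
proof (rule lborel_pair.Fubini_integrable)
  note [measurable] = borel_measurable_integrable[OF g] borel_measurable_integrable[OF h]
  show "(\<lambda>(y, x). g (x - y) * h y) \<in> borel_measurable (lborel \<Otimes>\<^sub>M lborel)" by measurable
  have "(LINT x|lborel. norm (g (x - y) * h y)) = L1norm g * norm (h y)" for y
    using L1norm_shift[of g y] by (simp add: norm_mult L1norm_def)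
  then show "integrable lborel (\<lambda>y. LINT x|lborel. norm (case (y, x) of (y, x) \<Rightarrow> g (x - y) * h y))"
    using h by simp
  show "AE y in lborel. integrable lborel (\<lambda>x. case (y, x) of (y, x) \<Rightarrow> g (x - y) * h y)"
    using integrable_shift[OF g] by simp
qed

lemma integrable_conv:
  assumes "integrable lborel g" "integrable lborel h"
  shows "integrable lborel (conv g h)"
  using lborel_pair.integrable_snd[OF integrable_conv_pair[OF assms]]
  by (simp add: conv_def[abs_def])

text \<open>Fubini, with the bounded factor absorbed into a dominating constant. Boundedness of
  \<open>f\<close> makes the identity hold at every point, whatever values \<open>conv g h\<close>
  takes on a null set.\<close>

lemma conv_assoc:
  assumes f[measurable]: "f \<in> borel_measurable borel" and B: "\<And>x. norm (f x) \<le> B"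
    and g: "integrable lborel g" and h: "integrable lborel h"
  shows "conv f (conv g h) x = conv (conv f g) h x"
proof -
  note [measurable] = borel_measurable_integrable[OF g] borel_measurable_integrable[OF h]
  have int: "integrable (lborel \<Otimes>\<^sub>M lborel) (\<lambda>(z, y). f (x - y) * (g (y - z) * h z))"
  proof (rule Bochner_Integration.integrable_bound)
    show "integrable (lborel \<Otimes>\<^sub>M lborel) (\<lambda>p. B * norm (case p of (z, y) \<Rightarrow> g (y - z) * h z))"
      using integrable_conv_pair[OF g h] by auto
    have "0 \<le> B" using B norm_ge_zero order_trans by blast
    then show "AE p in lborel \<Otimes>\<^sub>M lborel. norm (case p of (z, y) \<Rightarrow> f (x - y) * (g (y - z) * h z))
        \<le> norm (B * norm (case p of (z, y) \<Rightarrow> g (y - z) * h z))"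
      using B by (intro AE_I2) (auto simp: norm_mult intro!: mult_right_mono)
  qed measurable
  have "conv f (conv g h) x = (LINT y|lborel. LINT z|lborel. f (x - y) * (g (y - z) * h z))"
    unfolding conv_def by simp
  also have "\<dots> = (LINT z|lborel. LINT y|lborel. f (x - y) * (g (y - z) * h z))"
    by (rule lborel_pair.Fubini_integral[OF int])
  also have "\<dots> = (LINT z|lborel. (LINT y|lborel. f (x - y) * g (y - z)) * h z)"
    by (simp add: mult.assoc[symmetric])
  also have "\<dots> = conv (conv f g) h x"
  proof -
    have "(LINT y|lborel. f (x - y) * g (y - z)) = conv f g (x - z)" for z
      using integral_shift[of "\<lambda>y. f (x - z - y) * g y" z] by (simp add: conv_def)
    then show ?thesis by (simp add: conv_def)
  qed
  finally show ?thesis .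
qed

text \<open>The difference is the integral of \<open>(g (x - y) - g x) * k y\<close> over
  \<open>y\<close>; taking norms inside and exchanging the integrals gives the averaged
  modulus.\<close>

lemma L1norm_conv_diff_le:
  assumes g: "integrable lborel g" and k: "integrable lborel k"
  shows "L1norm (\<lambda>x. conv g k x - (LINT y|lborel. k y) * g x)
           \<le> (LINT y|lborel. transl_modulus g y * norm (k y))"
proof -
  note [measurable] = borel_measurable_integrable[OF g] borel_measurable_integrable[OF k]
  have prod: "integrable (lborel \<Otimes>\<^sub>M lborel) (\<lambda>(y, x). g x * k y)"
  proof (rule lborel_pair.Fubini_integrable)
    show "(\<lambda>(y, x). g x * k y) \<in> borel_measurable (lborel \<Otimes>\<^sub>M lborel)" by measurable
  qed (use g k in \<open>auto simp: norm_mult\<close>)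
  have int: "integrable (lborel \<Otimes>\<^sub>M lborel) (\<lambda>(y, x). (g (x - y) - g x) * k y)"
    using Bochner_Integration.integrable_diff[OF integrable_conv_pair[OF g k] prod]
    by (simp add: case_prod_unfold algebra_simps)
  then have int': "integrable (lborel \<Otimes>\<^sub>M lborel) (\<lambda>(y, x). norm ((g (x - y) - g x) * k y))"
    using integrable_norm[OF int] by (simp add: case_prod_unfold)
  have "AE x in lborel. norm (conv g k x - (LINT y|lborel. k y) * g x)
      \<le> (LINT y|lborel. norm ((g (x - y) - g x) * k y))"
    \<comment> \<open>The integral may be split only where the convolution converges, which is
      almost everywhere.\<close>
    using lborel_pair.AE_integrable_snd[OF integrable_conv_pair[OF g k]]
  proof eventually_elim
    case (elim x)
    have "conv g k x - (LINT y|lborel. k y) * g x = (LINT y|lborel. g (x - y) * k y - g x * k y)"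
      using elim k by (simp add: conv_def)
    also have "norm \<dots> \<le> (LINT y|lborel. norm (g (x - y) * k y - g x * k y))"
      by (rule integral_norm_bound)
    finally show ?case by (simp add: algebra_simps)
  qed
  then have "L1norm (\<lambda>x. conv g k x - (LINT y|lborel. k y) * g x)
      \<le> (LINT x|lborel. LINT y|lborel. norm ((g (x - y) - g x) * k y))"
    unfolding L1norm_def using integrable_conv[OF g k] g lborel_pair.integrable_snd[OF int']
    by (intro integral_mono_AE) auto
  also have "\<dots> = (LINT y|lborel. LINT x|lborel. norm ((g (x - y) - g x) * k y))"
    by (rule lborel_pair.Fubini_integral[OF int'])
  also have "\<dots> = (LINT y|lborel. transl_modulus g y * norm (k y))"
    by (simp add: norm_mult transl_modulus_def L1norm_def)
  finally show ?thesis .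
qed

lemma conv_tendsto_0:
  assumes [measurable]: "\<phi> \<in> borel_measurable borel" and B: "\<And>x. norm (\<phi> x) \<le> B"
    and lim: "(\<phi> \<longlongrightarrow> 0) at_top" and g: "integrable lborel g"
  shows "(conv \<phi> g \<longlongrightarrow> 0) at_top"
proof -
  note [measurable] = borel_measurable_integrable[OF g]
  have "((\<lambda>x. LINT y|lborel. \<phi> (x - y) * g y) \<longlongrightarrow> (LINT y::real|lborel. 0)) at_top"
  proof (rule integral_dominated_convergence_at_top[where w = "\<lambda>y. B * norm (g y)"])
    have "filterlim (\<lambda>x. x - y) at_top at_top" for y :: real
      using filterlim_tendsto_add_at_top[OF tendsto_const[of "-y"] filterlim_ident] by simp
    then show "AE y in lborel. ((\<lambda>x. \<phi> (x - y) * g y) \<longlongrightarrow> 0) at_top"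
      by (intro AE_I2 tendsto_mult_left_zero filterlim_compose[OF lim])
    show "\<forall>\<^sub>F x in at_top. AE y in lborel. norm (\<phi> (x - y) * g y) \<le> B * norm (g y)"
      using B by (intro always_eventually allI AE_I2) (simp add: norm_mult mult_right_mono)
  qed (use g in auto)
  then show ?thesis by (simp add: conv_def[abs_def])
qed

subsection \<open>The ideal of kernels with vanishing limit\<close>

text \<open>If L is the upper limit of the norm of \<open>\<phi>\<close>, the equation gives
  \<open>norm c * L \<le> L1norm D * L\<close>, because the convolution asymptotically sees only
  values of \<open>\<phi>\<close> far to the right. As L is finite, it is 0. The upper limit is
  replaced by the eventual bounds \<open>C * q ^ n\<close>.\<close>

lemma contraction_tendsto_0:
  assumes \<phi>[measurable]: "\<phi> \<in> borel_measurable borel" and B: "\<And>x. norm (\<phi> x) \<le> B"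
    and D: "integrable lborel D" and small: "L1norm D < norm c"
    and eq: "\<And>x. c * \<phi> x = conv \<phi> D x + r x" and r: "(r \<longlongrightarrow> 0) at_top"
  shows "(\<phi> \<longlongrightarrow> 0) at_top"
proof -
  have c: "norm c > 0" using small L1norm_nonneg[of D] by linarith
  \<comment> \<open>The midpoint of \<open>L1norm D / norm c\<close> and 1: it leaves the room
    \<open>(norm c - L1norm D) / 2\<close> for the error terms.\<close>
  define q where "q = (L1norm D / norm c + 1) / 2"
  have q0: "q > 0" using c L1norm_nonneg[of D] by (simp add: q_def add_nonneg_pos)
  have q1: "q < 1" using small c by (simp add: q_def)
  \<comment> \<open>The bound \<open>B\<close> may be 0, whereas \<open>C\<close> has to be positive
    for the strict estimates.\<close>
  define C where "C = B + 1"
  have "B \<ge> 0" using B norm_ge_zero order_trans by blast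
  then have C: "C > 0" by (simp add: C_def)
  have ev: "\<forall>\<^sub>F x in at_top. norm (\<phi> x) \<le> C * q ^ n" for n
  proof (induction n)
    case 0
    show ?case using B by (intro always_eventually allI) (simp add: C_def add_increasing2)
  next
    case (Suc n)
    define S where "S = C * q ^ n"
    have S: "S > 0" using C q0 by (simp add: S_def)
    obtain X where X: "\<And>x. x \<ge> X \<Longrightarrow> norm (\<phi> x) \<le> S"
      using Suc unfolding eventually_at_top_linorder S_def by blast
    \<comment> \<open>The right part obeys the bound \<open>S\<close> already reached; the left part
      vanishes eventually, so its convolution with \<open>D\<close> tends to 0.\<close>
    define \<phi>1 where "\<phi>1 x = (if x \<ge> X then \<phi> x else 0)" for x
    define \<phi>2 where "\<phi>2 x = (if x \<ge> X then 0 else \<phi> x)" for x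
    have m1[measurable]: "\<phi>1 \<in> borel_measurable borel" and m2[measurable]: "\<phi>2 \<in> borel_measurable borel"
      unfolding \<phi>1_def \<phi>2_def by measurable
    have b1: "norm (\<phi>1 x) \<le> S" for x using X[of x] S by (simp add: \<phi>1_def)
    have b2: "norm (\<phi>2 x) \<le> B" for x using B[of x] \<open>B \<ge> 0\<close> by (simp add: \<phi>2_def)
    have split: "conv \<phi> D x = conv \<phi>1 D x + conv \<phi>2 D x" for x
    proof -
      have "conv \<phi> D x = (LINT y|lborel. \<phi>1 (x - y) * D y + \<phi>2 (x - y) * D y)"
        unfolding conv_def by (intro Bochner_Integration.integral_cong) (auto simp: \<phi>1_def \<phi>2_def)
      also have "\<dots> = conv \<phi>1 D x + conv \<phi>2 D x"
        unfolding conv_def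
        using integrable_conv_bounded[OF m1 b1 D] integrable_conv_bounded[OF m2 b2 D] by simp
      finally show ?thesis .
    qed
    have "(\<phi>2 \<longlongrightarrow> 0) at_top"
      by (rule tendsto_eventually) (auto simp: \<phi>2_def eventually_at_top_linorder)
    then have "(conv \<phi>2 D \<longlongrightarrow> 0) at_top"
      by (rule conv_tendsto_0[OF m2 b2 _ D])
    from tendsto_add[OF this r] have "((\<lambda>x. norm (conv \<phi>2 D x + r x)) \<longlongrightarrow> 0) at_top"
      by (simp add: tendsto_norm_zero_iff)
    then have "\<forall>\<^sub>F x in at_top. norm (conv \<phi>2 D x + r x) < S * ((norm c - L1norm D) / 2)"
      by (rule order_tendstoD(2)) (use S small in simp)
    then show ?case
    proof eventually_elim
      case (elim x)
      have "norm c * norm (\<phi> x) = norm (conv \<phi>1 D x + (conv \<phi>2 D x + r x))"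
        using eq[of x] by (simp add: split norm_mult[symmetric] algebra_simps)
      also have "\<dots> \<le> norm (conv \<phi>1 D x) + norm (conv \<phi>2 D x + r x)" by (rule norm_triangle_ineq)
      also have "\<dots> \<le> S * L1norm D + S * ((norm c - L1norm D) / 2)"
        using norm_conv_le[OF m1 b1 D, of x] elim by (intro add_mono) auto
      also have "\<dots> = norm c * (S * q)" using c by (simp add: q_def field_simps)
      finally have "norm (\<phi> x) \<le> S * q" using c by simp
      then show ?case by (simp add: S_def algebra_simps)
    qed
  qed
  show ?thesis
  proof (rule tendstoI)
    fix e :: real assume "e > 0"
    have "(\<lambda>n. C * q ^ n) \<longlonglongrightarrow> C * 0"
      using q0 q1 by (intro tendsto_intros LIMSEQ_power_zero) auto
    then have "\<forall>\<^sub>F n in sequentially. C * q ^ n < e"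
      using \<open>e > 0\<close> by (intro order_tendstoD(2)) auto
    then obtain n where n: "C * q ^ n < e" by (auto dest: eventually_happens)
    from ev[of n] show "\<forall>\<^sub>F x in at_top. dist (\<phi> x) 0 < e"
      by eventually_elim (use n in simp)
  qed
qed

locale bounded_measurable =
  fixes f :: "real \<Rightarrow> complex" and B :: real
  assumes f_meas[measurable]: "f \<in> borel_measurable borel"
    and f_bound: "\<And>x. norm (f x) \<le> B"
begin

definition vanishing :: "(real \<Rightarrow> complex) set" where
  "vanishing = {h. integrable lborel h \<and> (conv f h \<longlongrightarrow> 0) at_top}"

lemma B_nonneg: "0 \<le> B"
  using f_bound norm_ge_zero order_trans by blast

lemma vanishing_conv:
  assumes "h \<in> vanishing" "integrable lborel g"
  shows "conv h g \<in> vanishing"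
proof -
  have h: "integrable lborel h" "(conv f h \<longlongrightarrow> 0) at_top" using assms by (auto simp: vanishing_def)
  have "(conv (conv f h) g \<longlongrightarrow> 0) at_top"
    using h assms(2) norm_conv_le[OF f_meas f_bound h(1)]
    by (intro conv_tendsto_0[of "conv f h" "B * L1norm h"]) auto
  moreover have "conv f (conv h g) = conv (conv f h) g"
    using conv_assoc[OF f_meas f_bound h(1) assms(2)] by (rule ext)
  ultimately show ?thesis
    using integrable_conv[OF h(1) assms(2)] by (simp add: vanishing_def)
qed

lemma vanishing_sum:
  assumes "finite I" "\<And>i. i \<in> I \<Longrightarrow> h i \<in> vanishing"
  shows "(\<lambda>x. c * (\<Sum>i\<in>I. h i x)) \<in> vanishing"
proof -
  have int: "\<And>i. i \<in> I \<Longrightarrow> integrable lborel (h i)" and lim: "\<And>i. i \<in> I \<Longrightarrow> (conv f (h i) \<longlongrightarrow> 0) at_top"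
    using assms by (auto simp: vanishing_def)
  have "conv f (\<lambda>x. c * (\<Sum>i\<in>I. h i x)) = (\<lambda>x. c * (\<Sum>i\<in>I. conv f (h i) x))"
  proof
    fix x
    have "conv f (\<lambda>x. c * (\<Sum>i\<in>I. h i x)) x = (LINT y|lborel. c * (\<Sum>i\<in>I. f (x - y) * h i y))"
      by (simp add: conv_def sum_distrib_left mult_ac)
    also have "\<dots> = c * (\<Sum>i\<in>I. conv f (h i) x)"
      using integrable_conv_bounded[OF f_meas f_bound int]
      by (simp add: conv_def)
    finally show "conv f (\<lambda>x. c * (\<Sum>i\<in>I. h i x)) x = c * (\<Sum>i\<in>I. conv f (h i) x)" .
  qed
  moreover have "((\<lambda>x. c * (\<Sum>i\<in>I. conv f (h i) x)) \<longlongrightarrow> c * (\<Sum>i\<in>I. 0)) at_top"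
    using lim by (intro tendsto_intros)
  ultimately show ?thesis using int by (simp add: vanishing_def)
qed

lemma conv_cong_AE:
  assumes "AE x in lborel. g x = h x" and [measurable]: "g \<in> borel_measurable borel" "h \<in> borel_measurable borel"
  shows "conv f g x = conv f h x"
  unfolding conv_def using assms(1) by (intro integral_cong_AE) (measurable, auto)

lemma vanishing_closed:
  assumes h: "integrable lborel h"
    and appr: "\<And>e. e > 0 \<Longrightarrow> \<exists>g\<in>vanishing. L1norm (\<lambda>x. h x - g x) < e"
  shows "h \<in> vanishing"
proof -
  have "(conv f h \<longlongrightarrow> 0) at_top"
  proof (rule tendstoI)
    fix e :: real assume e: "e > 0"
    have B: "B + 1 > 0" using B_nonneg by simp
    obtain g where g: "integrable lborel g" "(conv f g \<longlongrightarrow> 0) at_top"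
      and close: "L1norm (\<lambda>x. h x - g x) < e / (2 * (B + 1))"
      using appr[of "e / (2 * (B + 1))"] e B by (auto simp: vanishing_def)
    have "\<forall>\<^sub>F x in at_top. norm (conv f g x) < e / 2"
      using tendstoD[OF g(2), of "e/2"] e by simp
    then show "\<forall>\<^sub>F x in at_top. dist (conv f h x) 0 < e"
    proof eventually_elim
      case (elim x)
      have "conv f h x = conv f g x + conv f (\<lambda>x. h x - g x) x"
        using integrable_conv_bounded[OF f_meas f_bound g(1), of x]
          integrable_conv_bounded[OF f_meas f_bound h, of x]
        by (simp add: conv_def algebra_simps)
      then have "norm (conv f h x) \<le> norm (conv f g x) + norm (conv f (\<lambda>x. h x - g x) x)"
        by (simp add: norm_triangle_ineq)
      also have "norm (conv f (\<lambda>x. h x - g x) x) \<le> B * L1norm (\<lambda>x. h x - g x)"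
        using g h by (intro norm_conv_le f_meas f_bound) auto
      also have "\<dots> \<le> (B + 1) * (e / (2 * (B + 1)))"
        using B_nonneg close L1norm_nonneg by (intro mult_mono) auto
      also have "\<dots> = e / 2" using B by (simp add: field_simps)
      finally show ?case using elim by simp
    qed
  qed
  then show ?thesis using h by (simp add: vanishing_def)
qed

text \<open>Local inversion: near a frequency where the transform of \<open>K\<close> equals \<open>c \<noteq> 0\<close>, convolution with
  \<open>K\<close> differs from multiplication by \<open>c\<close> by a contraction, so the upper limit of
  \<open>\<bar>conv f h\<bar>\<close> must vanish.\<close>

lemma vanishing_local:
  assumes K: "K \<in> vanishing" and V: "integrable lborel V" and h: "integrable lborel h"
    and Vh: "AE x in lborel. conv V h x = h x"
    and small: "L1norm (\<lambda>x. c * V x - conv V K x) < norm c"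
  shows "h \<in> vanishing"
proof -
  have Ki: "integrable lborel K" and Kl: "(conv f K \<longlongrightarrow> 0) at_top" using K by (auto simp: vanishing_def)
  note [measurable] = borel_measurable_integrable[OF V, simplified] borel_measurable_integrable[OF h, simplified]
    borel_measurable_integrable[OF Ki, simplified]
  define \<phi> where "\<phi> = conv f h"
  define D where "D x = c * V x - conv V K x" for x
  have VK: "integrable lborel (conv V K)" by (rule integrable_conv[OF V Ki])
  have m\<phi>[measurable]: "\<phi> \<in> borel_measurable borel" unfolding \<phi>_def by measurable
  have b\<phi>: "norm (\<phi> x) \<le> B * L1norm h" for x
    unfolding \<phi>_def by (intro norm_conv_le f_meas f_bound h)
  \<comment> \<open>\<open>V\<close> reproduces \<open>h\<close>, hence also
    \<open>f * h\<close>.\<close>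
  have \<phi>V: "conv \<phi> V = \<phi>"
  proof
    fix x
    have "conv \<phi> V x = conv f (conv h V) x"
      unfolding \<phi>_def by (rule conv_assoc[symmetric, OF f_meas f_bound h V])
    also have "conv h V = conv V h" by (rule ext) (rule conv_commute)
    also have "conv f (conv V h) x = \<phi> x"
      unfolding \<phi>_def by (rule conv_cong_AE[OF Vh]) measurable
    finally show "conv \<phi> V x = \<phi> x" .
  qed
  have "(\<phi> \<longlongrightarrow> 0) at_top"
  proof (rule contraction_tendsto_0)
    show "integrable lborel D" unfolding D_def using V VK by auto
    show "L1norm D < norm c" using small by (simp add: D_def[abs_def])
    \<comment> \<open>Writing * for convolution: c \<phi> - \<phi> * D = \<phi> * V * K = \<phi> * K
      = (f * K) * h, which tends to 0 because \<open>K\<close> lies in the ideal.\<close>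
    show "c * \<phi> x = conv \<phi> D x + conv (conv f K) h x" for x
    proof -
      have "conv \<phi> D x = (LINT y|lborel. c * (\<phi> (x - y) * V y) - \<phi> (x - y) * conv V K y)"
        by (simp add: conv_def[of \<phi>] D_def algebra_simps)
      also have "\<dots> = c * conv \<phi> V x - conv \<phi> (conv V K) x"
        using integrable_conv_bounded[OF m\<phi> b\<phi> V, of x] integrable_conv_bounded[OF m\<phi> b\<phi> VK, of x]
        by (simp add: conv_def[of \<phi>])
      also have "conv \<phi> (conv V K) x = conv (conv \<phi> V) K x"
        by (rule conv_assoc[OF m\<phi> b\<phi> V Ki])
      also have "\<dots> = conv f (conv h K) x"
        unfolding \<phi>V unfolding \<phi>_def by (rule conv_assoc[symmetric, OF f_meas f_bound h Ki])
      also have "conv h K = conv K h" by (rule ext) (rule conv_commute)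
      also have "conv f (conv K h) x = conv (conv f K) h x"
        by (rule conv_assoc[OF f_meas f_bound Ki h])
      finally show ?thesis by (simp add: \<phi>V)
    qed
    show "(conv (conv f K) h \<longlongrightarrow> 0) at_top"
      using Kl h norm_conv_le[OF f_meas f_bound Ki]
      by (intro conv_tendsto_0[of "conv f K" "B * L1norm K"]) auto
  qed (use b\<phi> in auto)
  then show ?thesis using h by (simp add: vanishing_def \<phi>_def)
qed

end

subsection \<open>The Fejer and de la Vallee Poussin kernels\<close>

text \<open>Both kernels take the junk value 0 at the origin, which is why the identities below are stated away
  from the origin or almost everywhere.\<close>

definition fejer :: "real \<Rightarrow> real" where
  "fejer x = (1 - cos x) / x\<^sup>2"

definition vallee_poussin :: "real \<Rightarrow> real" where
  "vallee_poussin x = (cos x - cos (2 * x)) / x\<^sup>2"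

text \<open>The constant pi, kept symbolic; it normalises both kernels.\<close>

definition fejer_mass :: real where
  "fejer_mass = (LINT x|lborel. fejer x)"

lemma borel_measurable_fejer[measurable]: "fejer \<in> borel_measurable borel"
  unfolding fejer_def by measurable

lemma borel_measurable_vallee_poussin[measurable]: "vallee_poussin \<in> borel_measurable borel"
  unfolding vallee_poussin_def by measurable

lemma fejer_nonneg: "0 \<le> fejer x"
  unfolding fejer_def by (simp add: cos_le_one)

text \<open>The sum of two bounds: \<open>1 - cos x\<close> is at most half the square of x, and at
  most 2.\<close>

lemma fejer_le: "fejer x \<le> 5 / 2 * inverse (1 + x\<^sup>2)"
proof (cases "x = 0")
  case False
  have "1 - cos x = 2 * (sin (x / 2))\<^sup>2" using cos_double_sin[of "x/2"] by simp
  moreover have "(sin (x / 2))\<^sup>2 \<le> (x / 2)\<^sup>2"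
    using abs_sin_x_le_abs_x[of "x/2"] abs_le_square_iff by blast
  ultimately have "1 - cos x \<le> x\<^sup>2 / 2" by (simp add: power_divide)
  moreover have "(1 - cos x) * x\<^sup>2 \<le> 2 * x\<^sup>2"
    using cos_ge_minus_one[of x] by (intro mult_right_mono) auto
  ultimately have "(1 - cos x) * (1 + x\<^sup>2) \<le> 5 / 2 * x\<^sup>2" by (simp add: algebra_simps)
  then show ?thesis
    using False by (simp add: fejer_def divide_inverse[symmetric] field_simps add_pos_nonneg)
qed (simp add: fejer_def)

lemma integrable_fejer: "integrable lborel fejer"
proof (rule Bochner_Integration.integrable_bound)
  have "set_integrable lborel UNIV (\<lambda>x::real. inverse (1 + x\<^sup>2))"
    using integrable_inverse_1_plus_square by simp
  then show "integrable lborel (\<lambda>x::real. 5 / 2 * inverse (1 + x\<^sup>2))"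
    by (simp add: set_integrable_def)
  show "AE x in lborel. norm (fejer x) \<le> norm (5 / 2 * inverse (1 + x\<^sup>2))"
    using fejer_le fejer_nonneg by (intro AE_I2) (simp add: order_trans[OF _ abs_ge_self])
qed measurable

text \<open>A nonnegative function of integral 0 vanishes almost everywhere, but
  \<open>fejer\<close> is positive on the interval from 1 to 2.\<close>

lemma fejer_mass_pos: "fejer_mass > 0"
proof -
  have "fejer_mass \<noteq> 0"
  proof
    assume "fejer_mass = 0"
    then have "AE x in lborel. fejer x = 0"
      unfolding fejer_mass_def
      using integral_nonneg_eq_0_iff_AE[OF integrable_fejer] fejer_nonneg by simp
    then have "AE x in lborel. x \<notin> {1..2::real}"
    proof eventually_elim
      case (elim x)
      show ?case
      proof
        assume x: "x \<in> {1..2}"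
        then have "cos x < cos 0" using pi_gt3 by (intro cos_monotone_0_pi) auto
        then show False using elim x by (simp add: fejer_def)
      qed
    qed
    then have "{1..2::real} \<in> null_sets lborel" by (subst AE_iff_null_sets) auto
    then show False by (simp add: null_sets_def)
  qed
  moreover have "fejer_mass \<ge> 0" unfolding fejer_mass_def using fejer_nonneg by simp
  ultimately show ?thesis by simp
qed

text \<open>Dilation by \<open>a\<close>. The absolute value is the source of the piecewise linear
  Fourier transforms of both kernels.\<close>

lemma has_integral_one_minus_cos:
  "has_bochner_integral lborel (\<lambda>x. (1 - cos (a * x)) / x\<^sup>2) (\<bar>a\<bar> * fejer_mass)"
proof (cases "a = 0")
  case False
  have eq: "(1 - cos (a * x)) / x\<^sup>2 = a\<^sup>2 * fejer (a * x)" for x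
    using False by (simp add: fejer_def power_mult_distrib)
  have "fejer_mass = \<bar>a\<bar> * (LINT x|lborel. fejer (a * x))"
    using lborel_integral_real_affine[of a fejer 0] False by (simp add: fejer_mass_def)
  then have "a\<^sup>2 * (LINT x|lborel. fejer (a * x)) = \<bar>a\<bar> * fejer_mass"
    by (metis abs_mult_self_eq mult.assoc power2_eq_square)
  then show ?thesis
    unfolding eq using integrable_scale[OF integrable_fejer False]
    by (simp add: has_bochner_integral_iff)
qed (simp add: has_bochner_integral_zero)

lemma integrable_vallee_poussin: "integrable lborel vallee_poussin"
proof -
  have eq: "vallee_poussin = (\<lambda>x. (1 - cos (2 * x)) / x\<^sup>2 - (1 - cos (1 * x)) / x\<^sup>2)"
    by (rule ext) (simp add: vallee_poussin_def diff_divide_distrib)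
  show ?thesis
    unfolding eq using has_integral_one_minus_cos[of 1] has_integral_one_minus_cos[of 2]
    by (intro Bochner_Integration.integrable_diff) (simp_all only: has_bochner_integral_iff)
qed

text \<open>The transform of \<open>vallee_poussin\<close> is a trapezoid, and this is its plateau.
  By the product formula it is half of \<bar>2 + \<xi>\<bar> + \<bar>2 - \<xi>\<bar> - \<bar>1 +
  \<xi>\<bar> - \<bar>1 - \<xi>\<bar>, times \<open>fejer_mass\<close>; for \<bar>\<xi>\<bar> \<le>
  1 the four terms sum to 2.\<close>

lemma integral_vallee_poussin_cos:
  assumes "\<bar>\<xi>\<bar> \<le> 1"
  shows "(LINT x|lborel. vallee_poussin x * cos (\<xi> * x)) = fejer_mass"
proof -
  let ?g = "\<lambda>a x::real. (1 - cos (a * x)) / x\<^sup>2"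
  have eq: "vallee_poussin x * cos (\<xi> * x) = 1/2 * (?g (2 + \<xi>) x + ?g (2 - \<xi>) x - ?g (1 + \<xi>) x - ?g (1 - \<xi>) x)" for x
  proof -
    have "cos ((1 + \<xi>) * x) + cos ((1 - \<xi>) * x) = 2 * (cos x * cos (\<xi> * x))"
      "cos ((2 + \<xi>) * x) + cos ((2 - \<xi>) * x) = 2 * (cos (2 * x) * cos (\<xi> * x))"
      by (simp_all add: distrib_right left_diff_distrib cos_add cos_diff)
    then have "1/2 * ((1 - cos ((2 + \<xi>) * x)) + (1 - cos ((2 - \<xi>) * x)) - (1 - cos ((1 + \<xi>) * x)) - (1 - cos ((1 - \<xi>) * x)))
        = (cos x - cos (2 * x)) * cos (\<xi> * x)"
      by (simp add: algebra_simps)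
    then show ?thesis
      unfolding vallee_poussin_def by (simp add: add_divide_distrib[symmetric] diff_divide_distrib[symmetric])
  qed
  have "has_bochner_integral lborel (\<lambda>x. 1/2 * (?g (2 + \<xi>) x + ?g (2 - \<xi>) x - ?g (1 + \<xi>) x - ?g (1 - \<xi>) x))
     (1/2 * (\<bar>2 + \<xi>\<bar> * fejer_mass + \<bar>2 - \<xi>\<bar> * fejer_mass - \<bar>1 + \<xi>\<bar> * fejer_mass - \<bar>1 - \<xi>\<bar> * fejer_mass))"
    by (intro has_bochner_integral_mult_right has_bochner_integral_diff has_bochner_integral_add
        has_integral_one_minus_cos)
  then have "(LINT x|lborel. vallee_poussin x * cos (\<xi> * x)) =
      1/2 * (\<bar>2 + \<xi>\<bar> * fejer_mass + \<bar>2 - \<xi>\<bar> * fejer_mass - \<bar>1 + \<xi>\<bar> * fejer_mass - \<bar>1 - \<xi>\<bar> * fejer_mass)"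
    unfolding eq by (simp only: has_bochner_integral_iff)
  also have "\<dots> = fejer_mass"
  proof -
    have "\<bar>2 + \<xi>\<bar> = 2 + \<xi>" "\<bar>2 - \<xi>\<bar> = 2 - \<xi>" "\<bar>1 + \<xi>\<bar> = 1 + \<xi>" "\<bar>1 - \<xi>\<bar> = 1 - \<xi>"
      using assms by auto
    then show ?thesis by (simp only:) (simp add: algebra_simps)
  qed
  finally show ?thesis .
qed

text \<open>The integrand is odd.\<close>

lemma integral_vallee_poussin_sin: "(LINT x|lborel. vallee_poussin x * sin (\<xi> * x)) = 0"
  using integral_reflect_shift[of "\<lambda>x. vallee_poussin x * sin (\<xi> * x)" 0]
  by (simp add: vallee_poussin_def)

lemma integrable_vallee_poussin_mult:
  assumes [measurable]: "u \<in> borel_measurable borel" and "\<And>x. \<bar>u x\<bar> \<le> 1"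
  shows "integrable lborel (\<lambda>x. vallee_poussin x * u x)"
proof (rule Bochner_Integration.integrable_bound[OF integrable_vallee_poussin])
  show "AE x in lborel. norm (vallee_poussin x * u x) \<le> norm (vallee_poussin x)"
    using assms(2) by (intro AE_I2) (simp add: abs_mult mult_left_le)
qed measurable

text \<open>Integration by parts: \<open>fejer\<close> is the cosine transform of the triangle
  \<open>1 - \<xi>\<close>. At the origin the integral is 1/2, while \<open>fejer 0\<close> is
  0.\<close>

lemma fejer_fourier:
  assumes "y \<noteq> 0"
  shows "(LINT \<xi>|lborel. indicator {0..1} \<xi> * ((1 - \<xi>) * cos (\<xi> * y))) = fejer y"
proof -
  have "(LINT \<xi>|lborel. indicator {0..1} \<xi> *\<^sub>R ((1 - \<xi>) * cos (\<xi> * y)))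
      = ((1 - 1) * sin (1 * y) / y - cos (1 * y) / y\<^sup>2) - ((1 - 0) * sin (0 * y) / y - cos (0 * y) / y\<^sup>2)"
  proof (rule integral_FTC_atLeastAtMost)
    fix \<xi> :: real
    have "((\<lambda>\<xi>. (1 - \<xi>) * sin (\<xi> * y) / y - cos (\<xi> * y) / y\<^sup>2) has_real_derivative (1 - \<xi>) * cos (\<xi> * y)) (at \<xi> within {0..1})"
      using assms by (auto intro!: derivative_eq_intros simp: field_simps power2_eq_square)
    then show "((\<lambda>\<xi>. (1 - \<xi>) * sin (\<xi> * y) / y - cos (\<xi> * y) / y\<^sup>2) has_vector_derivative (1 - \<xi>) * cos (\<xi> * y)) (at \<xi> within {0..1})"
      by (simp add: has_real_derivative_iff_has_vector_derivative)
  qed (auto intro!: continuous_intros)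
  also have "\<dots> = fejer y" by (simp add: fejer_def diff_divide_distrib)
  finally show ?thesis by simp
qed

text \<open>Expand \<open>fejer\<close> into frequencies between 0 and 1 and exchange the integrals:
  on each of them convolution with \<open>vallee_poussin\<close> is multiplication by
  \<open>fejer_mass\<close>.\<close>

lemma vallee_poussin_fejer:
  assumes "x \<noteq> 0"
  shows "(LINT y|lborel. vallee_poussin (x - y) * fejer y) = fejer_mass * fejer x"
proof -
  let ?F = "\<lambda>y \<xi>. vallee_poussin (x - y) * (indicator {0..1} \<xi> * ((1 - \<xi>) * cos (\<xi> * y)))"
  have int: "integrable (lborel \<Otimes>\<^sub>M lborel) (case_prod ?F)"
  proof (rule Bochner_Integration.integrable_bound)
    show "integrable (lborel \<Otimes>\<^sub>M lborel) (\<lambda>(y, \<xi>). vallee_poussin (x - y) * indicator {0..1::real} \<xi>)"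
    proof (rule lborel_pair.Fubini_integrable)
      show "(\<lambda>(y, \<xi>). vallee_poussin (x - y) * indicator {0..1::real} \<xi>) \<in> borel_measurable (lborel \<Otimes>\<^sub>M lborel)"
        by measurable
    qed (use integrable_reflect_shift[OF integrable_vallee_poussin] in \<open>auto simp: abs_mult\<close>)
    show "AE p in lborel \<Otimes>\<^sub>M lborel. norm (case_prod ?F p) \<le> norm (case p of (y, \<xi>) \<Rightarrow> vallee_poussin (x - y) * indicator {0..1::real} \<xi>)"
      by (intro AE_I2) (auto simp: abs_mult indicator_def intro!: mult_left_le mult_le_one)
  qed measurable
  have "(LINT y|lborel. vallee_poussin (x - y) * fejer y) = (LINT y|lborel. LINT \<xi>|lborel. ?F y \<xi>)"
  proof (rule integral_cong_AE)
    show "AE y in lborel. vallee_poussin (x - y) * fejer y = (LINT \<xi>|lborel. ?F y \<xi>)"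
      using AE_lborel_singleton[of 0] by eventually_elim (simp add: fejer_fourier)
  qed measurable
  also have "\<dots> = (LINT \<xi>|lborel. LINT y|lborel. ?F y \<xi>)"
    by (rule lborel_pair.Fubini_integral[OF int, symmetric])
  also have "\<dots> = (LINT \<xi>|lborel. fejer_mass * (indicator {0..1} \<xi> * ((1 - \<xi>) * cos (\<xi> * x))))"
  proof (intro Bochner_Integration.integral_cong refl)
    fix \<xi> :: real
    show "(LINT y|lborel. ?F y \<xi>) = fejer_mass * (indicator {0..1} \<xi> * ((1 - \<xi>) * cos (\<xi> * x)))"
    proof (cases "\<xi> \<in> {0..1}")
      case True
      have "(LINT y|lborel. vallee_poussin (x - y) * cos (\<xi> * y))
          = (LINT y|lborel. vallee_poussin y * cos (\<xi> * (x - y)))"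
        using integral_reflect_shift[of "\<lambda>y. vallee_poussin y * cos (\<xi> * (x - y))" x] by simp
      \<comment> \<open>The addition formula; the sine term integrates to 0 by oddness, the cosine
        term by the plateau value.\<close>
      also have "\<dots> = (LINT y|lborel. cos (\<xi> * x) * (vallee_poussin y * cos (\<xi> * y)) + sin (\<xi> * x) * (vallee_poussin y * sin (\<xi> * y)))"
        by (intro Bochner_Integration.integral_cong) (simp_all add: right_diff_distrib cos_diff algebra_simps)
      also have "\<dots> = cos (\<xi> * x) * fejer_mass"
        using integrable_vallee_poussin_mult[of "\<lambda>y. cos (\<xi> * y)"] integrable_vallee_poussin_mult[of "\<lambda>y. sin (\<xi> * y)"]
          integral_vallee_poussin_cos[of \<xi>] integral_vallee_poussin_sin[of \<xi>] True
        by simp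
      finally have *: "(LINT y|lborel. vallee_poussin (x - y) * cos (\<xi> * y)) = cos (\<xi> * x) * fejer_mass" .
      have "(LINT y|lborel. ?F y \<xi>) = (LINT y|lborel. (1 - \<xi>) * (vallee_poussin (x - y) * cos (\<xi> * y)))"
        using True by (intro Bochner_Integration.integral_cong) (simp_all add: algebra_simps)
      also have "\<dots> = (1 - \<xi>) * (cos (\<xi> * x) * fejer_mass)" using * by simp
      finally show ?thesis using True by simp
    qed simp
  qed
  also have "\<dots> = fejer_mass * fejer x" using assms by (simp add: fejer_fourier)
  finally show ?thesis .
qed

text \<open>\<open>2 * (1 - cos t)\<close> is the squared modulus of \<open>cis t - 1\<close>.
  Factor \<open>cis (M * \<theta>) - 1\<close> as a geometric sum and expand its squared modulus.
  Without division the identity also covers cos \<theta> = 1.\<close>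

lemma one_minus_cos_eq_sum:
  "complex_of_real (1 - cos (real M * \<theta>))
     = (\<Sum>(j,k)\<in>{..<M}\<times>{..<M}. cis ((real j - real k) * \<theta>)) * complex_of_real (1 - cos \<theta>)"
proof -
  have sq: "(cis t - 1) * (cis (- t) - 1) = 2 * complex_of_real (1 - cos t)" for t
    by (simp add: complex_eq_iff algebra_simps)
  have geo: "cis (real M * t) - 1 = (cis t - 1) * (\<Sum>j<M. cis (real j * t))" for t
    unfolding Complex.DeMoivre[symmetric] by (rule power_diff_1_eq)
  have "2 * complex_of_real (1 - cos (real M * \<theta>)) = (cis (real M * \<theta>) - 1) * (cis (real M * (-\<theta>)) - 1)"
    using sq[of "real M * \<theta>"] by simp
  also have "\<dots> = ((cis \<theta> - 1) * (cis (- \<theta>) - 1)) * ((\<Sum>j<M. cis (real j * \<theta>)) * (\<Sum>k<M. cis (real k * (-\<theta>))))"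
    unfolding geo by (simp only: mult_ac)
  also have "(\<Sum>j<M. cis (real j * \<theta>)) * (\<Sum>k<M. cis (real k * (-\<theta>)))
      = (\<Sum>(j,k)\<in>{..<M}\<times>{..<M}. cis ((real j - real k) * \<theta>))"
    by (simp add: sum_product sum.cartesian_product cis_mult algebra_simps)
  finally show ?thesis
    unfolding sq mult.assoc mult_cancel_left by (simp add: mult.commute)
qed

subsection \<open>Wiener's Tauberian theorem\<close>

text \<open>The sign agrees with that of \<open>mult_hat\<close> under the substitution t = exp
  u.\<close>

definition fourier :: "(real \<Rightarrow> complex) \<Rightarrow> real \<Rightarrow> complex" where
  "fourier g \<xi> = (LINT y|lborel. g y * cis (- \<xi> * y))"

lemma borel_measurable_cis[measurable]: "cis \<in> borel_measurable borel"
  by (intro borel_measurable_continuous_onI continuous_intros)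

lemma integrable_mult_cis:
  fixes g :: "real \<Rightarrow> complex"
  assumes g: "integrable lborel g"
  shows "integrable lborel (\<lambda>y. cis (\<xi> * y) * g y)"
proof -
  note [measurable] = borel_measurable_integrable[OF g]
  show ?thesis
    by (rule Bochner_Integration.integrable_bound[OF g]) (auto simp: norm_mult)
qed

lemma continuous_on_fourier:
  assumes g: "integrable lborel g"
  shows "continuous_on A (fourier g)"
proof -
  note [measurable] = borel_measurable_integrable[OF g]
  have "isCont (fourier g) \<xi>" for \<xi>
  proof (rule continuous_at_sequentiallyI)
    fix X :: "nat \<Rightarrow> real" assume X: "X \<longlonglongrightarrow> \<xi>"
    show "(\<lambda>n. fourier g (X n)) \<longlonglongrightarrow> fourier g \<xi>"
      unfolding fourier_def
    proof (rule integral_dominated_convergence[where w = "\<lambda>y. norm (g y)"])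
      show "AE y in lborel. (\<lambda>n. g y * cis (- X n * y)) \<longlonglongrightarrow> g y * cis (- \<xi> * y)"
        by (intro AE_I2 tendsto_intros X)
    qed (use g in \<open>auto simp: norm_mult\<close>)
  qed
  then show ?thesis by (intro continuous_at_imp_continuous_on) auto
qed

text \<open>The transform is a triangle supported on [\<xi> - d, \<xi> + d]. There is no factor
  \<open>d\<close>, as only membership in a linear space matters.\<close>

definition mod_fejer :: "real \<Rightarrow> real \<Rightarrow> real \<Rightarrow> complex" where
  "mod_fejer \<xi> d x = cis (\<xi> * x) * complex_of_real (fejer (d * x))"

definition unit_vallee_poussin :: "real \<Rightarrow> complex" where
  "unit_vallee_poussin x = complex_of_real (vallee_poussin x / fejer_mass)"

text \<open>The transform equals 1 on [\<xi> - d, \<xi> + d], the support for the matching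
  \<open>mod_fejer\<close>. The factor \<open>d\<close> keeps the L1 norm independent of the
  bandwidth.\<close>

definition mod_vallee_poussin :: "real \<Rightarrow> real \<Rightarrow> real \<Rightarrow> complex" where
  "mod_vallee_poussin \<xi> d x = cis (\<xi> * x) * (d * unit_vallee_poussin (d * x))"

lemma integrable_unit_vallee_poussin: "integrable lborel unit_vallee_poussin"
  unfolding unit_vallee_poussin_def[abs_def] using integrable_vallee_poussin by auto

lemma integrable_mod_fejer:
  assumes "d \<noteq> 0"
  shows "integrable lborel (mod_fejer \<xi> d)"
  unfolding mod_fejer_def[abs_def]
  using integrable_scale[OF integrable_fejer assms] by (intro integrable_mult_cis) auto

lemma integrable_mod_vallee_poussin:
  assumes "d \<noteq> 0"
  shows "integrable lborel (mod_vallee_poussin \<xi> d)"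
  unfolding mod_vallee_poussin_def[abs_def]
  using integrable_scale[OF integrable_unit_vallee_poussin assms] by (intro integrable_mult_cis) auto

lemma conv_mod_vallee_poussin_fejer:
  assumes d: "d > 0" and x: "x \<noteq> 0"
  shows "conv (mod_vallee_poussin \<xi> d) (mod_fejer \<xi> d) x = mod_fejer \<xi> d x"
proof -
  let ?I = "\<lambda>y. vallee_poussin (d * x - y) * fejer y"
  have "mod_vallee_poussin \<xi> d (x - y) * mod_fejer \<xi> d y
      = cis (\<xi> * x) / fejer_mass * complex_of_real (d * ?I (d * y))" for y
  proof -
    \<comment> \<open>The common frequency factors out of the convolution, leaving the dilated
      unmodulated kernels.\<close>
    have "cis (\<xi> * x) = cis (\<xi> * (x - y)) * cis (\<xi> * y)" by (simp add: cis_mult algebra_simps)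
    then show ?thesis
      by (simp add: mod_vallee_poussin_def mod_fejer_def unit_vallee_poussin_def right_diff_distrib)
  qed
  then have "conv (mod_vallee_poussin \<xi> d) (mod_fejer \<xi> d) x
      = cis (\<xi> * x) / fejer_mass * complex_of_real (d * (LINT y|lborel. ?I (d * y)))"
    by (simp only: conv_def integral_mult_right_zero integral_complex_of_real)
  also have "d * (LINT y|lborel. ?I (d * y)) = (LINT y|lborel. ?I y)"
    using integral_scale[OF d, of ?I] by simp
  also have "\<dots> = fejer_mass * fejer (d * x)"
    using d x by (intro vallee_poussin_fejer) simp
  finally show ?thesis using fejer_mass_pos by (simp add: mod_fejer_def[of \<xi> d x])
qed

text \<open>Norm-preserving dilation turns a shift by \<open>y\<close> into one by
  \<open>d * y\<close>: a kernel of small bandwidth \<open>d\<close> is wide and hardly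
  moves.\<close>

lemma transl_modulus_scale:
  assumes "d > 0"
  shows "transl_modulus (\<lambda>x. d * g (d * x)) y = transl_modulus g (d * y)"
proof -
  have "transl_modulus (\<lambda>x. d * g (d * x)) y = (LINT x|lborel. d * norm (g (d * x - d * y) - g (d * x)))"
    unfolding transl_modulus_def L1norm_def using assms
    by (simp add: right_diff_distrib[symmetric] norm_mult)
  also have "\<dots> = transl_modulus g (d * y)"
    using integral_scale[OF assms, of "\<lambda>x. norm (g (x - d * y) - g x)"]
    by (simp add: transl_modulus_def L1norm_def)
  finally show ?thesis .
qed

text \<open>The bound does not depend on \<open>\<xi>\<close>; this replaces a compactness argument over frequencies.\<close>

lemma L1norm_mod_vallee_poussin_le:
  assumes d: "d > 0" and K: "integrable lborel K"
  shows "L1norm (\<lambda>x. fourier K \<xi> * mod_vallee_poussin \<xi> d x - conv (mod_vallee_poussin \<xi> d) K x)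
      \<le> (LINT y|lborel. transl_modulus unit_vallee_poussin (d * y) * norm (K y))"
proof -
  let ?W = "\<lambda>x. d * unit_vallee_poussin (d * x)"
  let ?K = "\<lambda>y. K y * cis (- \<xi> * y)"
  \<comment> \<open>The modulation is moved from the kernel onto \<open>K\<close>, whose integral
    thereby becomes \<open>fourier K \<xi>\<close>; the remaining factor has modulus 1.\<close>
  have "conv (mod_vallee_poussin \<xi> d) K x = cis (\<xi> * x) * conv ?W ?K x" for x
  proof -
    have "mod_vallee_poussin \<xi> d (x - y) * K y = cis (\<xi> * x) * (?W (x - y) * ?K y)" for y
    proof -
      have "cis (\<xi> * (x - y)) = cis (\<xi> * x) * cis (- \<xi> * y)" by (simp add: cis_mult algebra_simps)
      then show ?thesis by (simp add: mod_vallee_poussin_def)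
    qed
    then show ?thesis by (simp only: conv_def integral_mult_right_zero)
  qed
  then have "fourier K \<xi> * mod_vallee_poussin \<xi> d x - conv (mod_vallee_poussin \<xi> d) K x
      = cis (\<xi> * x) * - (conv ?W ?K x - (LINT y|lborel. ?K y) * ?W x)" for x
    by (simp add: mod_vallee_poussin_def fourier_def algebra_simps)
  then have "L1norm (\<lambda>x. fourier K \<xi> * mod_vallee_poussin \<xi> d x - conv (mod_vallee_poussin \<xi> d) K x)
      = L1norm (\<lambda>x. conv ?W ?K x - (LINT y|lborel. ?K y) * ?W x)"
    unfolding L1norm_def by (simp only: norm_mult norm_cis norm_minus_cancel mult_1)
  also have "\<dots> \<le> (LINT y|lborel. transl_modulus ?W y * norm (?K y))"
  proof (rule L1norm_conv_diff_le)
    show "integrable lborel ?W"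
      using integrable_scale[OF integrable_unit_vallee_poussin, of d] d by auto
    show "integrable lborel ?K"
      using integrable_mult_cis[OF K, of "-\<xi>"] by (simp add: mult.commute)
  qed
  also have "\<dots> = (LINT y|lborel. transl_modulus unit_vallee_poussin (d * y) * norm (K y))"
    using transl_modulus_scale[OF d] by (simp add: norm_mult)
  finally show ?thesis .
qed

text \<open>This is \<open>one_minus_cos_eq_sum\<close> at \<theta> = d x, with d = R/M, divided by
  the square of d x. At x = 0 both sides are 0 by the default value of division.\<close>

lemma fejer_eq_sum_mod_fejer:
  assumes "M > 0"
  shows "complex_of_real (fejer (R * x))
     = 1 / (of_nat M)\<^sup>2 * (\<Sum>(j,k)\<in>{..<M}\<times>{..<M}. mod_fejer ((real j - real k) * (R / M)) (R / M) x)"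
proof -
  define d where "d = R / M"
  have Rx: "R * x = real M * (d * x)" using assms by (simp add: d_def)
  have "(\<Sum>(j,k)\<in>{..<M}\<times>{..<M}. mod_fejer ((real j - real k) * d) d x)
      = (\<Sum>(j,k)\<in>{..<M}\<times>{..<M}. cis ((real j - real k) * (d * x))) * complex_of_real (fejer (d * x))"
    by (simp add: mod_fejer_def sum_distrib_right case_prod_unfold mult.assoc)
  also have "\<dots> = complex_of_real (1 - cos (real M * (d * x))) / complex_of_real ((d * x)\<^sup>2)"
    unfolding one_minus_cos_eq_sum by (simp add: fejer_def)
  also have "\<dots> = (of_nat M)\<^sup>2 * complex_of_real (fejer (R * x))"
    unfolding Rx using assms by (simp add: fejer_def power_mult_distrib)
  finally show ?thesis using assms by (simp add: d_def)
qed

section \<open>From one kernel with nonvanishing transform to all integrable kernels\<close>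

context bounded_measurable
begin

lemma fejer_vanishing:
  assumes K: "K \<in> vanishing" and nz: "\<And>\<xi>. fourier K \<xi> \<noteq> 0" and R: "R > 0"
  shows "(\<lambda>x. complex_of_real (fejer (R * x))) \<in> vanishing"
proof -
  have Ki: "integrable lborel K" using K by (simp add: vanishing_def)
  \<comment> \<open>Compactness is needed only for a positive lower bound of the transform; together
    with the frequency-free error bound it allows a single bandwidth \<open>d\<close> for all
    centres.\<close>
  have "\<exists>\<xi>0\<in>{-R..R}. \<forall>\<xi>\<in>{-R..R}. norm (fourier K \<xi>0) \<le> norm (fourier K \<xi>)"
    using R by (intro continuous_attains_inf continuous_on_norm continuous_on_fourier Ki) auto
  then obtain \<xi>0 where m: "\<And>\<xi>. \<bar>\<xi>\<bar> \<le> R \<Longrightarrow> norm (fourier K \<xi>0) \<le> norm (fourier K \<xi>)"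
    by (metis abs_le_D1 abs_le_D2 atLeastAtMost_iff minus_le_iff)
  have "(\<lambda>i. R / real (Suc i)) \<longlonglongrightarrow> 0"
    using LIMSEQ_Suc[OF lim_const_over_n[of R]] by simp
  from tendsto_integral_transl_modulus[OF integrable_unit_vallee_poussin Ki this]
  have "\<forall>\<^sub>F i in sequentially.
      (LINT y|lborel. transl_modulus unit_vallee_poussin (R / real (Suc i) * y) * norm (K y)) < norm (fourier K \<xi>0)"
    by (rule order_tendstoD(2)) (simp add: nz)
  then obtain i where i:
    "(LINT y|lborel. transl_modulus unit_vallee_poussin (R / real (Suc i) * y) * norm (K y)) < norm (fourier K \<xi>0)"
    by (auto dest: eventually_happens)
  define M where "M = Suc i"
  define d where "d = R / M"
  have M: "M > 0" by (simp add: M_def)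
  have d: "d > 0" using R by (simp add: d_def M_def)
  have piece: "mod_fejer \<xi> d \<in> vanishing" if "\<bar>\<xi>\<bar> \<le> R" for \<xi>
  proof (rule vanishing_local[OF K])
    show "integrable lborel (mod_vallee_poussin \<xi> d)" "integrable lborel (mod_fejer \<xi> d)"
      using d by (auto intro: integrable_mod_vallee_poussin integrable_mod_fejer)
    show "AE x in lborel. conv (mod_vallee_poussin \<xi> d) (mod_fejer \<xi> d) x = mod_fejer \<xi> d x"
      using AE_lborel_singleton[of 0] by eventually_elim (rule conv_mod_vallee_poussin_fejer[OF d])
    have "L1norm (\<lambda>x. fourier K \<xi> * mod_vallee_poussin \<xi> d x - conv (mod_vallee_poussin \<xi> d) K x)
        \<le> (LINT y|lborel. transl_modulus unit_vallee_poussin (d * y) * norm (K y))"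
      by (rule L1norm_mod_vallee_poussin_le[OF d Ki])
    also have "\<dots> < norm (fourier K \<xi>0)" using i by (simp add: d_def M_def)
    also have "\<dots> \<le> norm (fourier K \<xi>)" by (rule m[OF that])
    finally show "L1norm (\<lambda>x. fourier K \<xi> * mod_vallee_poussin \<xi> d x - conv (mod_vallee_poussin \<xi> d) K x)
        < norm (fourier K \<xi>)" .
  qed
  \<comment> \<open>The centres are (j - k) d with j, k < M and M d = R, so all lie within
    [-R, R].\<close>
  have "(\<lambda>x. 1 / (of_nat M)\<^sup>2 * (\<Sum>p\<in>{..<M}\<times>{..<M}. mod_fejer ((real (fst p) - real (snd p)) * d) d x)) \<in> vanishing"
  proof (intro vanishing_sum piece)
    fix p assume p: "p \<in> {..<M} \<times> {..<M}"
    have "\<bar>(real (fst p) - real (snd p)) * d\<bar> = \<bar>real (fst p) - real (snd p)\<bar> * d"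
      using d by (simp add: abs_mult)
    also have "\<dots> \<le> real M * d" using p d by (intro mult_right_mono) auto
    also have "\<dots> = R" using M by (simp add: d_def)
    finally show "\<bar>(real (fst p) - real (snd p)) * d\<bar> \<le> R" .
  qed simp
  then show ?thesis
    unfolding fejer_eq_sum_mod_fejer[OF M] by (simp add: d_def case_prod_unfold)
qed

theorem wiener_tauberian:
  assumes K: "integrable lborel K" and lim: "(conv f K \<longlongrightarrow> 0) at_top"
    and nz: "\<And>\<xi>. fourier K \<xi> \<noteq> 0" and H: "integrable lborel H"
  shows "(conv f H \<longlongrightarrow> 0) at_top"
proof -
  have "H \<in> vanishing"
  proof (rule vanishing_closed[OF H])
    fix e :: real assume e: "e > 0"
    define P where "P x = complex_of_real (fejer x / fejer_mass)" for x
    have P: "integrable lborel P" unfolding P_def using integrable_fejer by auto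
    have P1: "(LINT x|lborel. P x) = 1"
      unfolding P_def using fejer_mass_pos
      by (simp add: fejer_mass_def[symmetric])
    have "(\<lambda>i. 1 / real (Suc i)) \<longlonglongrightarrow> 0"
      using LIMSEQ_Suc[OF lim_const_over_n[of 1]] by simp
    from tendsto_integral_transl_modulus[OF H P this]
    have "\<forall>\<^sub>F i in sequentially. (LINT y|lborel. transl_modulus H (1 / real (Suc i) * y) * norm (P y)) < e"
      using e by (rule order_tendstoD(2))
    then obtain i where i: "(LINT y|lborel. transl_modulus H (1 / real (Suc i) * y) * norm (P y)) < e"
      by (auto dest: eventually_happens)
    define n where "n = real (Suc i)"
    have n: "n > 0" by (simp add: n_def)
    define Q where "Q x = n * P (n * x)" for x
    have Q: "integrable lborel Q"
      unfolding Q_def using integrable_scale[OF P, of n] n by auto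
    have Q1: "(LINT x|lborel. Q x) = 1"
      using integral_scale[OF n, of P] P1 by (simp add: Q_def scaleR_conv_of_real)
    have "L1norm (\<lambda>x. conv H Q x - H x) \<le> (LINT y|lborel. transl_modulus H y * norm (Q y))"
      using L1norm_conv_diff_le[OF H Q] Q1 by simp
    \<comment> \<open>Written in terms of \<open>n * y\<close>, so that the change of variable
      leaves the fixed kernel \<open>P\<close> and moves the scale into the shift.\<close>
    also have "\<dots> = n * (LINT y|lborel. transl_modulus H (1 / n * (n * y)) * norm (P (n * y)))"
      using n by (simp add: Q_def norm_mult mult_ac)
    also have "\<dots> = (LINT y|lborel. transl_modulus H (1 / n * y) * norm (P y))"
      using integral_scale[OF n, of "\<lambda>y. transl_modulus H (1 / n * y) * norm (P y)"] by simp
    also have "\<dots> < e" using i by (simp add: n_def)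
    finally have "L1norm (\<lambda>x. H x - conv H Q x) < e" by (simp add: L1norm_minus_commute)
    moreover have "conv H Q \<in> vanishing"
    proof -
      \<comment> \<open>The one-element sum expresses a scalar multiple.\<close>
      have "(\<lambda>x. (n / fejer_mass) * (\<Sum>i\<in>{()}. complex_of_real (fejer (n * x)))) \<in> vanishing"
        using fejer_vanishing[OF _ nz n] K lim by (intro vanishing_sum) (auto simp: vanishing_def)
      then have "Q \<in> vanishing" by (simp add: Q_def[abs_def] P_def)
      then have "conv Q H \<in> vanishing" using H by (rule vanishing_conv)
      also have "conv Q H = conv H Q" by (rule ext) (rule conv_commute)
      finally show ?thesis .
    qed
    ultimately show "\<exists>g\<in>vanishing. L1norm (\<lambda>x. H x - g x) < e" by blast
  qed
  then show ?thesis by (simp add: vanishing_def)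
qed

end

subsection \<open>Transfer to the multiplicative group\<close>

lemma space_haar_mult: "space haar_mult = {0<..}"
  by (simp add: haar_mult_def space_restrict_space)

lemma sets_haar_mult: "sets haar_mult = sets (restrict_space borel {0<..})"
  by (simp add: haar_mult_def sets_restrict_space)

lemma measurable_exp_haar: "exp \<in> measurable lborel haar_mult"
proof -
  have "exp \<in> measurable borel (restrict_space borel {0::real<..})"
    by (intro measurable_restrict_space2) auto
  then show ?thesis
    by (subst measurable_cong_sets[OF sets_lborel sets_haar_mult])
qed

lemma measurable_ln_haar: "ln \<in> borel_measurable haar_mult"
proof -
  have "ln \<in> borel_measurable (restrict_space borel {0::real<..})"
    by (intro measurable_restrict_space1) auto
  then show ?thesis
    by (subst measurable_cong_sets[OF sets_haar_mult refl])
qed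

text \<open>The substitution t = exp u is carried out on compact intervals exhausting the half-line,
  and monotone convergence passes to the limit. \<open>Suc n\<close> keeps the intervals
  nondegenerate.\<close>

lemma haar_mult_eq_distr: "haar_mult = distr lborel haar_mult exp"
proof (rule measure_eqI)
  fix A assume A: "A \<in> sets haar_mult"
  then have A': "A \<subseteq> {0<..}" and [measurable]: "A \<in> sets borel"
    by (auto simp: sets_haar_mult sets_restrict_space_iff sets_restrict_space)
  define h where "h t = ennreal (1 / t) * indicator A t" for t :: real
  have [measurable]: "h \<in> borel_measurable borel" unfolding h_def by measurable
  have "emeasure haar_mult A = (\<integral>\<^sup>+t. h t \<partial>restrict_space lborel {0<..})"
    unfolding haar_mult_def h_def using A
    by (subst emeasure_density)
       (auto simp: haar_mult_def sets_restrict_space_iff intro!: measurable_restrict_space1)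
  also have "\<dots> = (\<integral>\<^sup>+t. h t * indicator {0<..} t \<partial>lborel)"
    by (subst nn_integral_restrict_space) auto
  also have "\<dots> = (\<integral>\<^sup>+t. (SUP n. h t * indicator {exp (- real (Suc n))..exp (real (Suc n))} t) \<partial>lborel)"
  proof (rule nn_integral_cong)
    fix t :: real
    show "h t * indicator {0<..} t = (SUP n. h t * indicator {exp (- real (Suc n))..exp (real (Suc n))} t)"
    proof (cases "t > 0")
      case False
      then have "t \<notin> {exp (- real (Suc n))..exp (real (Suc n))}" for n
        by (auto intro: less_le_trans[OF exp_gt_zero])
      then show ?thesis using False by simp
    next
      case True
      obtain n where n: "\<bar>ln t\<bar> \<le> real n" using real_arch_simple by blast
      have "exp (- real (Suc n)) \<le> exp (ln t)" "exp (ln t) \<le> exp (real (Suc n))"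
        using n by (auto simp del: exp_ln)
      then have "t \<in> {exp (- real (Suc n))..exp (real (Suc n))}" using True by simp
      then have "h t \<le> (SUP n. h t * indicator {exp (- real (Suc n))..exp (real (Suc n))} t)"
        by (intro SUP_upper2[of n]) auto
      moreover have "(SUP n. h t * indicator {exp (- real (Suc n))..exp (real (Suc n))} t) \<le> h t"
        by (intro SUP_least) (auto simp: indicator_def)
      ultimately show ?thesis using True by simp
    qed
  qed
  also have "\<dots> = (SUP n. \<integral>\<^sup>+t. h t * indicator {exp (- real (Suc n))..exp (real (Suc n))} t \<partial>lborel)"
  proof (rule nn_integral_monotone_convergence_SUP)
    show "incseq (\<lambda>n t. h t * indicator {exp (- real (Suc n))..exp (real (Suc n))} t)"
    proof (intro incseq_SucI le_funI mult_left_mono)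
      fix n and t :: real
      have "exp (- real (Suc (Suc n))) \<le> exp (- real (Suc n))" "exp (real (Suc n)) \<le> exp (real (Suc (Suc n)))"
        by simp_all
      then show "indicator {exp (- real (Suc n))..exp (real (Suc n))} t
          \<le> (indicator {exp (- real (Suc (Suc n)))..exp (real (Suc (Suc n)))} t :: ennreal)"
        by (intro indicator_leI) (meson atLeastAtMost_iff order_trans)
    qed simp
  qed measurable
  also have "\<dots> = (SUP n. \<integral>\<^sup>+u. indicator (exp -` A) u * indicator {- real (Suc n)..real (Suc n)} u \<partial>lborel)"
  proof (intro SUP_cong refl)
    fix n
    have "(\<integral>\<^sup>+t. h t * indicator {exp (- real (Suc n))..exp (real (Suc n))} t \<partial>lborel)
        = (\<integral>\<^sup>+u. h (exp u) * ennreal (exp u) * indicator {- real (Suc n)..real (Suc n)} u \<partial>lborel)"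
      by (rule nn_integral_substitution_aux) (auto intro!: derivative_eq_intros continuous_intros)
    also have "\<dots> = (\<integral>\<^sup>+u. indicator (exp -` A) u * indicator {- real (Suc n)..real (Suc n)} u \<partial>lborel)"
    proof (intro nn_integral_cong)
      fix u :: real
      \<comment> \<open>The Haar density cancels the Jacobian of exp.\<close>
      have "ennreal (1 / exp u) * ennreal (exp u) = 1"
        by (simp add: ennreal_mult[symmetric])
      then show "h (exp u) * ennreal (exp u) * indicator {- real (Suc n)..real (Suc n)} u
          = indicator (exp -` A) u * indicator {- real (Suc n)..real (Suc n)} u"
        by (auto simp: h_def indicator_def)
    qed
    finally show "(\<integral>\<^sup>+t. h t * indicator {exp (- real (Suc n))..exp (real (Suc n))} t \<partial>lborel)
        = (\<integral>\<^sup>+u. indicator (exp -` A) u * indicator {- real (Suc n)..real (Suc n)} u \<partial>lborel)" .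
  qed
  also have "\<dots> = (\<integral>\<^sup>+u. (SUP n. indicator (exp -` A) u * indicator {- real (Suc n)..real (Suc n)} u) \<partial>lborel)"
  proof (rule nn_integral_monotone_convergence_SUP[symmetric])
    show "incseq (\<lambda>n u. indicator (exp -` A) u * indicator {- real (Suc n)..real (Suc n)} u :: ennreal)"
      by (intro incseq_SucI le_funI mult_left_mono) (auto simp: indicator_def)
    show "(\<lambda>u. indicator (exp -` A) u * indicator {- real (Suc n)..real (Suc n)} u :: ennreal) \<in> borel_measurable lborel" for n
      by measurable
  qed
  also have "\<dots> = (\<integral>\<^sup>+u. indicator (exp -` A) u \<partial>lborel)"
  proof (rule nn_integral_cong)
    fix u :: real
    obtain n where "\<bar>u\<bar> \<le> real n" using real_arch_simple by blast
    then have "u \<in> {- real (Suc n)..real (Suc n)}" by auto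
    then have "indicator (exp -` A) u \<le> (SUP n. indicator (exp -` A) u * indicator {- real (Suc n)..real (Suc n)} u :: ennreal)"
      by (intro SUP_upper2[of n]) (auto simp del: atLeastAtMost_iff)
    moreover have "(SUP n. indicator (exp -` A) u * indicator {- real (Suc n)..real (Suc n)} u :: ennreal) \<le> indicator (exp -` A) u"
      by (intro SUP_least) (auto simp: indicator_def)
    ultimately show "(SUP n. indicator (exp -` A) u * indicator {- real (Suc n)..real (Suc n)} u :: ennreal) = indicator (exp -` A) u"
      by simp
  qed
  also have "\<dots> = emeasure (distr lborel haar_mult exp) A"
    using emeasure_distr[OF measurable_exp_haar A] measurable_sets[OF measurable_exp_haar A] by simp
  finally show "emeasure haar_mult A = emeasure (distr lborel haar_mult exp) A" .
qed simp

text \<open>Measurability is asked only of \<open>G\<close>, so integrands built from \<psi> and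
  \<open>f\<close> may be arbitrary where their indicators vanish.\<close>

lemma integral_haar_mult:
  fixes G :: "real \<Rightarrow> complex"
  assumes [measurable]: "G \<in> borel_measurable borel" and eq: "\<And>t. t > 0 \<Longrightarrow> g t = G (ln t)"
  shows "(LINT t|haar_mult. g t) = (LINT u|lborel. G u)"
proof -
  note [measurable] = measurable_ln_haar
  have "(LINT t|haar_mult. g t) = (LINT t|distr lborel haar_mult exp. G (ln t))"
    using eq unfolding haar_mult_eq_distr[symmetric]
    by (intro Bochner_Integration.integral_cong) (auto simp: space_haar_mult)
  also have "\<dots> = (LINT u|lborel. G u)"
    by (subst integral_distr[OF measurable_exp_haar]) auto
  finally show ?thesis .
qed

lemma AE_haar_multD:
  assumes "AE t in haar_mult. P t"
  shows "AE u in lborel. P (exp u)"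
  using AE_distrD[OF measurable_exp_haar] assms haar_mult_eq_distr by metis

lemma tendsto_exp_at_top_iff:
  "((\<lambda>s::real. g (exp s)) \<longlongrightarrow> a) at_top \<longleftrightarrow> (g \<longlongrightarrow> a) at_top"
proof
  assume "((\<lambda>s. g (exp s)) \<longlongrightarrow> a) at_top"
  from filterlim_compose[OF this ln_at_top] have "((\<lambda>x. g (exp (ln x))) \<longlongrightarrow> a) at_top" .
  moreover have "\<forall>\<^sub>F x in at_top. g (exp (ln x)) = g x"
    using eventually_gt_at_top[of 0] by eventually_elim simp
  ultimately show "(g \<longlongrightarrow> a) at_top" by (rule Lim_transform_eventually)
qed (rule filterlim_compose[OF _ exp_at_top])

theorem theorem4p4:
  fixes \<psi> :: "real \<Rightarrow> complex"
  assumes psi_L1: "set_integrable haar_mult {1..} \<psi>"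
    and psi_int: "(LINT t:{1..}|haar_mult. \<psi> t) = 1"
    and psi_Z: "zero_set (ext_zero \<psi>) = {}"
  shows "\<forall>(f :: real \<Rightarrow> complex) (\<alpha> :: complex).
           set_borel_measurable haar_mult {1..} f \<longrightarrow>
           (\<exists>B. AE t in haar_mult. t \<in> {1..} \<longrightarrow> norm (f t) \<le> B) \<longrightarrow>
           (((\<lambda>x. LINT t:{1..x}|haar_mult. f t * \<psi> (x / t)) \<longlongrightarrow> \<alpha>) at_top
            \<longleftrightarrow> ((\<lambda>x. LINT t:{x..}|haar_mult. f t * \<psi> (t / x)) \<longlongrightarrow> \<alpha>) at_top)"
proof (intro allI impI)
  fix f :: "real \<Rightarrow> complex" and \<alpha> :: complex
  assume f: "set_borel_measurable haar_mult {1..} f"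
    and "\<exists>B. AE t in haar_mult. t \<in> {1..} \<longrightarrow> norm (f t) \<le> B"
  then obtain B where B: "AE t in haar_mult. t \<in> {1..} \<longrightarrow> norm (f t) \<le> B" by blast
  let ?I1 = "\<lambda>x. LINT t:{1..x}|haar_mult. f t * \<psi> (x / t)"
  let ?I2 = "\<lambda>x. LINT t:{x..}|haar_mult. f t * \<psi> (t / x)"
  define k where "k u = (if 0 \<le> u then \<psi> (exp u) else 0)" for u
  \<comment> \<open>With t = exp u and x = exp s, the factor \<psi>(t/x) is k(u - s), that is
    \<open>k' (s - u)\<close>; the second mean thus becomes a convolution with the reflected
    kernel.\<close>
  define k' where "k' u = k (- u)" for u
  have k_eq: "k = (\<lambda>u. indicator {1..} (exp u) *\<^sub>R \<psi> (exp u))"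
    by (auto simp: k_def fun_eq_iff indicator_def)
  have k: "integrable lborel k"
  proof -
    have "integrable (distr lborel haar_mult exp) (\<lambda>t. indicator {1..} t *\<^sub>R \<psi> t)"
      using psi_L1 unfolding set_integrable_def haar_mult_eq_distr[symmetric] .
    from integrable_distr[OF measurable_exp_haar this] show ?thesis by (simp add: k_eq)
  qed
  have k': "integrable lborel k'"
    unfolding k'_def using integrable_reflect_shift[OF k, of 0] by simp
  note [measurable] = borel_measurable_integrable[OF k, simplified] borel_measurable_integrable[OF k', simplified]
  have k1: "(LINT u|lborel. k u) = 1"
    using psi_int unfolding set_lebesgue_integral_def
    by (subst integral_haar_mult[of k, symmetric]) (auto simp: k_def indicator_def cong: if_cong)
  have k'1: "(LINT u|lborel. k' u) = 1"
    using integral_reflect_shift[of k 0] k1 by (simp add: k'_def)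
  have fk: "fourier k \<xi> \<noteq> 0" for \<xi>
  proof -
    have "mult_hat (ext_zero \<psi>) \<xi> = fourier k \<xi>"
      unfolding mult_hat_def fourier_def
      by (rule integral_haar_mult) (measurable, auto simp: k_def ext_zero_def)
    then show ?thesis using psi_Z by (auto simp: zero_set_def)
  qed
  have fk': "fourier k' \<xi> \<noteq> 0" for \<xi>
  proof -
    have "fourier k' \<xi> = fourier k (- \<xi>)"
      using integral_reflect_shift[of "\<lambda>y. k y * cis (\<xi> * y)" 0] by (simp add: fourier_def k'_def)
    then show ?thesis using fk by simp
  qed
  define F0 where "F0 u = (if 0 \<le> u then f (exp u) else 0)" for u
  have F0_eq: "F0 = (\<lambda>u. indicator {1..} (exp u) *\<^sub>R f (exp u))"
    by (auto simp: F0_def fun_eq_iff indicator_def)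
  have [measurable]: "F0 \<in> borel_measurable borel"
    using measurable_compose[OF measurable_exp_haar f[unfolded set_borel_measurable_def]]
    unfolding F0_eq by simp
  \<comment> \<open>Subtracting \<alpha> reduces the claim to limit 0. The cutoff at
    \<open>B\<close> changes the function only on a null set and turns the essential bound into one
    valid everywhere.\<close>
  define F where "F u = (if 0 \<le> u \<and> norm (F0 u) \<le> B then F0 u - \<alpha> else 0)" for u
  have F_AE: "AE u in lborel. 0 \<le> u \<longrightarrow> F0 u = F u + \<alpha>"
    using AE_haar_multD[OF B] by eventually_elim (auto simp: F_def F0_def)
  have F_neg: "F u = 0" if "u < 0" for u using that by (simp add: F_def)
  have mF[measurable]: "F \<in> borel_measurable borel" unfolding F_def by measurable
  have bF: "norm (F u) \<le> \<bar>B\<bar> + norm \<alpha>" for u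
    using norm_triangle_ineq4[of "F0 u" \<alpha>] by (auto simp: F_def)
  interpret bounded_measurable F "\<bar>B\<bar> + norm \<alpha>"
    using mF bF by unfold_locales auto

  \<comment> \<open>As \<alpha> is subtracted only for u \<ge> 0, the first mean misses the mass of
    \<open>k\<close> beyond s. That tail is \<open>conv N k s\<close>, which tends to 0.\<close>
  define N where "N = (\<lambda>u::real. if u < 0 then 1 else 0 :: complex)"
  have mN[measurable]: "N \<in> borel_measurable borel" unfolding N_def by measurable
  have bN: "norm (N u) \<le> 1" for u by (simp add: N_def)
  have "(N \<longlongrightarrow> 0) at_top"
    by (rule tendsto_eventually) (auto simp: N_def eventually_at_top_linorder intro!: exI[of _ 0])
  from conv_tendsto_0[OF mN bN this k] have Nk: "(conv N k \<longlongrightarrow> 0) at_top" .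

  have I1: "?I1 (exp s) = conv F k s + \<alpha> * (1 - conv N k s)" if "0 \<le> s" for s
  proof -
    have "?I1 (exp s) = (LINT u|lborel. F0 u * k (s - u))"
      unfolding set_lebesgue_integral_def
    proof (rule integral_haar_mult)
      fix t :: real assume t: "t > 0"
      have "exp (s - ln t) = exp s / t" using t by (simp add: exp_diff)
      moreover have "t \<le> exp s \<longleftrightarrow> ln t \<le> s" 
        using t exp_le_cancel_iff[of "ln t" s] by simp
      ultimately show "indicator {1..exp s} t *\<^sub>R (f t * \<psi> (exp s / t)) = F0 (ln t) * k (s - ln t)"
        using t by (auto simp: F0_def k_def indicator_def)
    qed measurable
    also have "\<dots> = (LINT u|lborel. k (s - u) * F u + \<alpha> * (k (s - u) - N u * k (s - u)))"
    proof (rule integral_cong_AE)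
      show "AE u in lborel. F0 u * k (s - u) = k (s - u) * F u + \<alpha> * (k (s - u) - N u * k (s - u))"
        using F_AE by eventually_elim (auto simp: N_def F_neg F0_def algebra_simps)
    qed measurable
    also have "\<dots> = conv k F s + \<alpha> * ((LINT u|lborel. k (s - u)) - (LINT u|lborel. N u * k (s - u)))"
    proof -
      have "integrable lborel (\<lambda>u. k (s - u))" by (rule integrable_reflect_shift[OF k])
      moreover have "integrable lborel (\<lambda>u. k (s - u) * F u)"
        using integrable_reflect_shift[OF integrable_conv_bounded[OF mF bF k, of s], of s] by (simp add: mult.commute)
      moreover have "integrable lborel (\<lambda>u. N u * k (s - u))"
        using integrable_reflect_shift[OF integrable_conv_bounded[OF mN bN k, of s], of s] by simp
      ultimately show ?thesis by (simp add: conv_def)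
    qed
    also have "(LINT u|lborel. k (s - u)) = 1" using integral_reflect_shift[of k s] k1 by simp
    also have "(LINT u|lborel. N u * k (s - u)) = conv N k s"
      using conv_commute[of N k s] by (simp add: conv_def mult.commute)
    also have "conv k F s = conv F k s" by (rule conv_commute)
    finally show ?thesis .
  qed
  \<comment> \<open>No tail term appears: \<open>k' (s - u)\<close> is nonzero only for u \<ge> s,
    and s \<ge> 0.\<close>
  have I2: "?I2 (exp s) = conv F k' s + \<alpha>" if "0 \<le> s" for s
  proof -
    have "?I2 (exp s) = (LINT u|lborel. F0 u * k' (s - u))"
      unfolding set_lebesgue_integral_def
    proof (rule integral_haar_mult)
      fix t :: real assume t: "t > 0"
      have "exp (ln t - s) = t / exp s" using t by (simp add: exp_diff)
      moreover have "exp s \<le> t \<longleftrightarrow> s \<le> ln t" using t by (simp add: ln_ge_iff)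
      moreover have "1 \<le> t" if "exp s \<le> t"
        using order_trans[OF _ that, of 1] \<open>0 \<le> s\<close> by simp
      ultimately show "indicator {exp s..} t *\<^sub>R (f t * \<psi> (t / exp s)) = F0 (ln t) * k' (s - ln t)"
        using t that by (auto simp: F0_def k_def k'_def indicator_def)
    qed measurable
    also have "\<dots> = (LINT u|lborel. k' (s - u) * F u + \<alpha> * k' (s - u))"
    proof (rule integral_cong_AE)
      show "AE u in lborel. F0 u * k' (s - u) = k' (s - u) * F u + \<alpha> * k' (s - u)"
        using F_AE by eventually_elim (use that in \<open>auto simp: k_def k'_def algebra_simps\<close>)
    qed measurable
    also have "\<dots> = conv k' F s + \<alpha> * (LINT u|lborel. k' (s - u))"
    proof -
      have "integrable lborel (\<lambda>u. k' (s - u))" by (rule integrable_reflect_shift[OF k'])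
      moreover have "integrable lborel (\<lambda>u. k' (s - u) * F u)"
        using integrable_reflect_shift[OF integrable_conv_bounded[OF mF bF k', of s], of s] by (simp add: mult.commute)
      ultimately show ?thesis by (simp add: conv_def)
    qed
    also have "(LINT u|lborel. k' (s - u)) = 1" using integral_reflect_shift[of k' s] k'1 by simp
    also have "conv k' F s = conv F k' s" by (rule conv_commute)
    finally show ?thesis by simp
  qed

  have "(?I1 \<longlongrightarrow> \<alpha>) at_top \<longleftrightarrow> ((\<lambda>s. ?I1 (exp s)) \<longlongrightarrow> \<alpha>) at_top"
    by (rule tendsto_exp_at_top_iff[symmetric])
  also have "\<dots> \<longleftrightarrow> ((\<lambda>s. conv F k s + \<alpha> * (1 - conv N k s)) \<longlongrightarrow> \<alpha>) at_top"
    by (intro tendsto_cong eventually_mono[OF eventually_ge_at_top[of 0]] I1)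
  also have "\<dots> \<longleftrightarrow> (conv F k \<longlongrightarrow> 0) at_top"
  proof -
    have lim: "((\<lambda>s. \<alpha> * (1 - conv N k s)) \<longlongrightarrow> \<alpha>) at_top"
      using tendsto_mult_left[OF tendsto_diff[OF tendsto_const[of 1] Nk], of \<alpha>] by simp
    show ?thesis
    proof
      assume "((\<lambda>s. conv F k s + \<alpha> * (1 - conv N k s)) \<longlongrightarrow> \<alpha>) at_top"
      from tendsto_diff[OF this lim] show "(conv F k \<longlongrightarrow> 0) at_top" by simp
    next
      assume "(conv F k \<longlongrightarrow> 0) at_top"
      from tendsto_add[OF this lim] show "((\<lambda>s. conv F k s + \<alpha> * (1 - conv N k s)) \<longlongrightarrow> \<alpha>) at_top" by simp
    qed
  qed
  \<comment> \<open>Wiener's theorem in both directions: neither \<open>fourier k\<close> nor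
    \<open>fourier k'\<close> has a zero, so each kernel controls the other.\<close>
  also have "\<dots> \<longleftrightarrow> (conv F k' \<longlongrightarrow> 0) at_top"
    using wiener_tauberian[OF k _ fk k'] wiener_tauberian[OF k' _ fk' k] by blast
  also have "\<dots> \<longleftrightarrow> ((\<lambda>s. conv F k' s + \<alpha>) \<longlongrightarrow> \<alpha>) at_top"
    using tendsto_add_const_iff[of \<alpha> "conv F k'" 0 at_top] by (simp add: add.commute)
  also have "\<dots> \<longleftrightarrow> ((\<lambda>s. ?I2 (exp s)) \<longlongrightarrow> \<alpha>) at_top"
    by (intro tendsto_cong eventually_mono[OF eventually_ge_at_top[of 0]] I2[symmetric])
  also have "\<dots> \<longleftrightarrow> (?I2 \<longlongrightarrow> \<alpha>) at_top"
    by (rule tendsto_exp_at_top_iff)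
  finally show "(?I1 \<longlongrightarrow> \<alpha>) at_top \<longleftrightarrow> (?I2 \<longlongrightarrow> \<alpha>) at_top" .
qed

end
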